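(* Let $N\ge 1$, let $\omega_0,\dots,\omega_{N-1}>0$ be constant Lagrangian markers, and let $\bar v>0$ with $\bar v\le\min_{i=0,\dots,N-1}\omega_i$ be the velocity of the leading vehicle. Consider the nonlocal microscopic traffic model described in the context, with gaps $y_i(t)=x_{i+1}(t)-x_i(t)$, $i=0,\dots,N-1$. Let $\bar L_i>0$ be the equilibrium distances determined by $$v\left(\frac{1}{N\bar L_i},\omega_i\right)=\bar v,\qquad i=0,\dots,N-1 .$$ Assume that there is a constant $v'_{\max}<0$ with $\max_{i\in\{0,\dots,N-1\}}\partial_\rho v(\rho,\omega_i)\le v'_{\max}$ for all admissible densities $\rho$. Then the stationary solution $y_i(t)=\bar L_i$, $i=0,\dots,N-1$, of the dynamics of the gaps is (locally) asymptotically stable.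
   Context: Kernel. Fix $\eta>0$ and $w\in C^1([0,\eta];[0,\infty))$ with $w'\le 0$ and $\int_0^\eta w(x)\,dx=1$. Set $\tilde w(x)=w(x)$ for $x\in[0,\eta]$ and $\tilde w(x)=0$ otherwise. Velocity. $v(\rho,\omega)$ is twice continuously differentiable in $\rho$ and continuously differentiable in $\omega$. For every $\omega>0$ there is $\rho^{\max}_\omega>0$ with $v(\rho^{\max}_\omega,\omega)=0$; the admissible densities for $\omega$ are $\rho\in[0,\rho^{\max}_\omega]$. On admissible densities: $v(\rho,\omega)\ge 0$, $v(0,\omega)=\omega$, $v(\rho,0)=0$; $\frac{\partial^2}{\partial\rho^2}\big(\rho v(\rho,\omega)\big)<0$ for $\omega>0$; and $\frac{\partial v}{\partial\omega}(\rho,\omega)>0$ for $0\le\rho<\rho^{\max}_\omega$. Microscopic model. There are $N+1$ cars with positions $x_0(t)<x_1(t)<\dots<x_N(t)$ satisfying, for $t>0$, $$\frac{d}{dt}x_i(t)=\sum_{j=0}^{N_\eta-1}\gamma_{i,j}(t)V_{i,j}(t),\quad i=0,\dots,N-1,\qquad \frac{d}{dt}x_N(t)=\bar v,$$ $$\frac{d}{dt}\omega_i(t)=0,\quad i=0,\dots,N-1,$$ (so $\omega_i(t)=\omega_i$), where $$V_{i,j}(t)=v\left(\frac{1}{N(x_{i+1+j}(t)-x_{i+j}(t))},\omega_{i+j}\right)\ \text{if } i+j\le N-1,\qquad V_{i,j}(t)=\bar v\ \text{if } i+j>N-1,$$ and the weights are $$\gamma_{i,j}(t)=\begin{cases}\int_{x_{i+j}(t)}^{x_{i+j+1}(t)}\tilde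 w(y-x_i(t))\,dy,& i+j\le N-1,\\ \int_{\min\{x_N(t),x_i(t)+\eta\}}^{x_i(t)+\eta}\tilde w(y-x_i(t))\,dy,& i+j=N,\\ 0,& i+j>N.\end{cases}$$ The integer $N_\eta$ is large enough that $x_{i+N_\eta}(t)-x_i(t)\ge\eta$ whenever $i+N_\eta\le N$ (so $\gamma_{i,j}=0$ for $j\ge N_\eta$ and $\sum_{j=0}^{N_\eta-1}\gamma_{i,j}(t)=1$). The right-hand sides depend only on the gaps, so $y=(y_0,\dots,y_{N-1})$ satisfies a closed autonomous system $\frac{d}{dt}y_i=F_i(y)$, of which $y_i\equiv\bar L_i$ is an equilibrium. *)

theory Defs
  imports "HOL-Analysis.Analysis"
begin

section \<open>Kernel and velocity\<close>

text \<open>Continuously differentiable on \<open>S\<close> with derivative \<open>f'\<close>; the derivative is the one within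
  \<open>S\<close>, hence one-sided at the endpoints of an interval.\<close>

definition C1_with_deriv :: "(real \<Rightarrow> real) \<Rightarrow> (real \<Rightarrow> real) \<Rightarrow> real set \<Rightarrow> bool" where
  "C1_with_deriv f f' S \<longleftrightarrow>
     (\<forall>x\<in>S. (f has_real_derivative f' x) (at x within S)) \<and> continuous_on S f'"

definition kernel :: "real \<Rightarrow> (real \<Rightarrow> real) \<Rightarrow> bool" where
  "kernel \<eta> w \<longleftrightarrow>
     (\<exists>w'. C1_with_deriv w w' {0..\<eta>} \<and> (\<forall>x\<in>{0..\<eta>}. w' x \<le> 0)) \<and>
     (\<forall>x\<in>{0..\<eta>}. 0 \<le> w x) \<and>
     (w has_integral 1) {0..\<eta>}"

definition kernel_ext :: "real \<Rightarrow> (real \<Rightarrow> real) \<Rightarrow> real \<Rightarrow> real" where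
  "kernel_ext \<eta> w x = (if x \<in> {0..\<eta>} then w x else 0)"

text \<open>\<open>rho_max \<omega>\<close> is the maximal density for the marker \<open>\<omega>\<close>, and \<open>v_rho\<close>, \<open>v_rho2\<close>, \<open>v_omega\<close> are
  the partial derivatives of \<open>v\<close>. Regularity is only required on the admissible densities
  \<open>{0..rho_max \<omega>}\<close>. For \<open>\<omega> = 0\<close> there is no maximal density, and \<open>v \<rho> 0 = 0\<close> is meant for all
  \<open>\<rho> \<ge> 0\<close>.\<close>

definition velocity_law ::
  "(real \<Rightarrow> real \<Rightarrow> real) \<Rightarrow> (real \<Rightarrow> real \<Rightarrow> real) \<Rightarrow> (real \<Rightarrow> real \<Rightarrow> real) \<Rightarrow> (real \<Rightarrow> real \<Rightarrow> real) \<Rightarrow>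
   (real \<Rightarrow> real) \<Rightarrow> bool" where
  "velocity_law v v_rho v_rho2 v_omega rho_max \<longleftrightarrow>
     (\<forall>\<omega>>0. rho_max \<omega> > 0 \<and> v (rho_max \<omega>) \<omega> = 0) \<and>
     (\<forall>\<omega>>0. C1_with_deriv (\<lambda>\<rho>. v \<rho> \<omega>) (\<lambda>\<rho>. v_rho \<rho> \<omega>) {0..rho_max \<omega>} \<and>
             C1_with_deriv (\<lambda>\<rho>. v_rho \<rho> \<omega>) (\<lambda>\<rho>. v_rho2 \<rho> \<omega>) {0..rho_max \<omega>}) \<and>
     (\<forall>\<rho>\<ge>0. C1_with_deriv (v \<rho>) (v_omega \<rho>) {\<omega>. 0 < \<omega> \<and> \<rho> \<le> rho_max \<omega>}) \<and>
     (\<forall>\<omega>>0. \<forall>\<rho>\<in>{0..rho_max \<omega>}. 0 \<le> v \<rho> \<omega>) \<and>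
     (\<forall>\<omega>\<ge>0. v 0 \<omega> = \<omega>) \<and>
     (\<forall>\<rho>\<ge>0. v \<rho> 0 = 0) \<and>
     (\<forall>\<omega>>0. \<exists>q1 q2. C1_with_deriv (\<lambda>\<rho>. \<rho> * v \<rho> \<omega>) q1 {0..rho_max \<omega>} \<and>
                    C1_with_deriv q1 q2 {0..rho_max \<omega>} \<and>
                    (\<forall>\<rho>\<in>{0..rho_max \<omega>}. q2 \<rho> < 0)) \<and>
     (\<forall>\<omega>>0. \<forall>\<rho>\<in>{0..<rho_max \<omega>}. 0 < v_omega \<rho> \<omega>)"

section \<open>Microscopic model\<close>

text \<open>Here \<open>x :: nat \<Rightarrow> real\<close> is the vector of positions \<open>x 0 < \<dots> < x N\<close> at one instant.\<close>

definition weight ::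
  "real \<Rightarrow> (real \<Rightarrow> real) \<Rightarrow> nat \<Rightarrow> (nat \<Rightarrow> real) \<Rightarrow> nat \<Rightarrow> nat \<Rightarrow> real" where
  "weight \<eta> w N x i j =
     (if i + j < N then integral {x (i + j)..x (i + j + 1)} (\<lambda>y. kernel_ext \<eta> w (y - x i))
      else if i + j = N then
        integral {min (x N) (x i + \<eta>)..x i + \<eta>} (\<lambda>y. kernel_ext \<eta> w (y - x i))
      else 0)"

definition local_speed ::
  "(real \<Rightarrow> real \<Rightarrow> real) \<Rightarrow> real \<Rightarrow> nat \<Rightarrow> (nat \<Rightarrow> real) \<Rightarrow> (nat \<Rightarrow> real) \<Rightarrow> nat \<Rightarrow> nat \<Rightarrow> real" where
  "local_speed v vbar N \<omega> x i j =
     (if i + j < N then v (1 / (real N * (x (i + 1 + j) - x (i + j)))) (\<omega> (i + j)) else vbar)"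

text \<open>The time derivative of the position of car \<open>i\<close>, for \<open>i \<le> N\<close>.\<close>

definition car_speed ::
  "real \<Rightarrow> (real \<Rightarrow> real) \<Rightarrow> (real \<Rightarrow> real \<Rightarrow> real) \<Rightarrow> real \<Rightarrow> nat \<Rightarrow> nat \<Rightarrow> (nat \<Rightarrow> real) \<Rightarrow>
   (nat \<Rightarrow> real) \<Rightarrow> nat \<Rightarrow> real" where
  "car_speed \<eta> w v vbar N N\<^sub>\<eta> \<omega> x i =
     (if i < N then \<Sum>j<N\<^sub>\<eta>. weight \<eta> w N x i j * local_speed v vbar N \<omega> x i j else vbar)"

text \<open>Positions with gaps \<open>y\<close>, normalised by \<open>x 0 = 0\<close>; the dynamics of the gaps does not depend on
  this choice, by the lemma \<open>gap_field_gaps\<close> below.\<close>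

definition positions :: "(nat \<Rightarrow> real) \<Rightarrow> nat \<Rightarrow> real" where
  "positions y k = (\<Sum>l<k. y l)"

definition gap_field ::
  "real \<Rightarrow> (real \<Rightarrow> real) \<Rightarrow> (real \<Rightarrow> real \<Rightarrow> real) \<Rightarrow> real \<Rightarrow> nat \<Rightarrow> nat \<Rightarrow> (nat \<Rightarrow> real) \<Rightarrow>
   (nat \<Rightarrow> real) \<Rightarrow> nat \<Rightarrow> real" where
  "gap_field \<eta> w v vbar N N\<^sub>\<eta> \<omega> y i =
     car_speed \<eta> w v vbar N N\<^sub>\<eta> \<omega> (positions y) (i + 1)
     - car_speed \<eta> w v vbar N N\<^sub>\<eta> \<omega> (positions y) i"

lemma positions_gaps: "positions (\<lambda>i. x (i + 1) - x i) k = x k - x 0"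
  by (induction k) (auto simp: positions_def)

lemma weight_shift: "weight \<eta> w N (\<lambda>k. x k - c) i j = weight \<eta> w N x i j"
proof -
  have *: "integral {a - c..b - c} (\<lambda>y. f (y - (d - c))) = integral {a..b} (\<lambda>y. f (y - d))"
    for a b d :: real and f :: "real \<Rightarrow> real"
    using integral_shift_Icc_real[of "a - c" "b - c" "\<lambda>y. f (y - d)" c]
    by (simp add: o_def algebra_simps)
  have "min (x N - c) (x i - c + \<eta>) = min (x N) (x i + \<eta>) - c" "x i - c + \<eta> = (x i + \<eta>) - c"
    by auto
  then show ?thesis
    unfolding weight_def by (simp only: *)
qed

lemma gap_field_gaps:
  "gap_field \<eta> w v vbar N N\<^sub>\<eta> \<omega> (\<lambda>i. x (i + 1) - x i) i =
     car_speed \<eta> w v vbar N N\<^sub>\<eta> \<omega> x (i + 1) - car_speed \<eta> w v vbar N N\<^sub>\<eta> \<omega> x i"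
proof -
  have "positions (\<lambda>i. x (i + 1) - x i) = (\<lambda>k. x k - x 0)"
    using positions_gaps by blast
  moreover have "local_speed v vbar N \<omega> (\<lambda>k. x k - x 0) i j = local_speed v vbar N \<omega> x i j" for i j
    by (simp add: local_speed_def)
  ultimately show ?thesis
    by (simp add: gap_field_def car_speed_def weight_shift)
qed

text \<open>The look-ahead number is large enough for the configuration with gaps \<open>y\<close>:
  \<open>x (i + N\<^sub>\<eta>) - x i \<ge> \<eta>\<close> whenever \<open>i + N\<^sub>\<eta> \<le> N\<close>.\<close>

definition horizon_covered :: "real \<Rightarrow> nat \<Rightarrow> nat \<Rightarrow> (nat \<Rightarrow> real) \<Rightarrow> bool" where
  "horizon_covered \<eta> N N\<^sub>\<eta> y \<longleftrightarrow>
     (\<forall>i. i + N\<^sub>\<eta> \<le> N \<longrightarrow> positions y (i + N\<^sub>\<eta>) - positions y i \<ge> \<eta>)"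

definition gap_domain :: "nat \<Rightarrow> (nat \<Rightarrow> real) set" where
  "gap_domain N = {y. \<forall>i<N. 0 < y i}"

section \<open>Asymptotic stability\<close>

text \<open>Vectors in dimension \<open>N\<close> are functions on \<open>nat\<close> of which only the values at \<open>i < N\<close> matter;
  \<open>near N r y p\<close> is the open ball of radius \<open>r\<close> about \<open>p\<close> in the maximum norm.\<close>

definition near :: "nat \<Rightarrow> real \<Rightarrow> (nat \<Rightarrow> real) \<Rightarrow> (nat \<Rightarrow> real) \<Rightarrow> bool" where
  "near N r y p \<longleftrightarrow> (\<forall>i<N. \<bar>y i - p i\<bar> < r)"

text \<open>\<open>y\<close> solves \<open>y' = F(y)\<close> on the time interval \<open>[0, T)\<close> and stays in the phase space \<open>D\<close>.\<close>

definition ode_solution ::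
  "nat \<Rightarrow> (nat \<Rightarrow> real) set \<Rightarrow> ((nat \<Rightarrow> real) \<Rightarrow> nat \<Rightarrow> real) \<Rightarrow> ereal \<Rightarrow> (real \<Rightarrow> nat \<Rightarrow> real) \<Rightarrow> bool"
  where
  "ode_solution N D F T y \<longleftrightarrow>
     (\<forall>t. 0 \<le> t \<and> ereal t < T \<longrightarrow> y t \<in> D) \<and>
     (\<forall>i<N. continuous_on {t. 0 \<le> t \<and> ereal t < T} (\<lambda>t. y t i)) \<and>
     (\<forall>i<N. \<forall>t. 0 < t \<and> ereal t < T \<longrightarrow> ((\<lambda>s. y s i) has_real_derivative F (y t) i) (at t))"

text \<open>The equilibrium \<open>p\<close> of \<open>y' = F(y)\<close> is locally asymptotically stable: nearby initial data
  have solutions for all times, \<open>p\<close> is Lyapunov stable, and \<open>p\<close> is locally attractive.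
  Lyapunov stability is required of every solution, including those given only up to some
  finite time.\<close>

definition asymptotically_stable ::
  "nat \<Rightarrow> (nat \<Rightarrow> real) set \<Rightarrow> ((nat \<Rightarrow> real) \<Rightarrow> nat \<Rightarrow> real) \<Rightarrow> (nat \<Rightarrow> real) \<Rightarrow> bool" where
  "asymptotically_stable N D F p \<longleftrightarrow>
     p \<in> D \<and> (\<forall>i<N. F p i = 0) \<and>
     (\<exists>r>0. \<forall>y0. near N r y0 p \<longrightarrow>
        (\<exists>y. ode_solution N D F \<infinity> y \<and> (\<forall>i<N. y 0 i = y0 i))) \<and>
     (\<forall>\<epsilon>>0. \<exists>\<delta>>0. \<forall>T y. ode_solution N D F T y \<and> near N \<delta> (y 0) p \<longrightarrow>
        (\<forall>t. 0 \<le> t \<and> ereal t < T \<longrightarrow> near N \<epsilon> (y t) p)) \<and>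
     (\<exists>\<delta>>0. \<forall>y. ode_solution N D F \<infinity> y \<and> near N \<delta> (y 0) p \<longrightarrow>
        (\<forall>i<N. ((\<lambda>t. y t i) \<longlongrightarrow> p i) at_top))"

end

theory Submission
  imports Defs "HOL-Probability.Discrete_Topology"
begin

text \<open>Since the weights of each car sum to one, its speed is \<open>vbar\<close> plus a weighted sum of the
  deviations \<open>v (1 / (N y\<^sub>k)) \<omega>\<^sub>k - vbar\<close> over the gaps \<open>k\<close> ahead. Hence the equation for the gap \<open>i\<close>
  involves only the gaps \<open>k \<ge> i\<close>: its own gap enters with a strictly damping sign, because \<open>v\<close> is strictly
  decreasing in the density and the weight of the gap directly ahead is positive, and the gaps further
  ahead enter with a Lipschitz bound. Such a triangular system has the Lyapunov function
  \<open>\<Sum>\<^sub>i M\<^sup>i (y\<^sub>i - L\<^sub>i)\<^sup>2\<close> for \<open>M\<close> large, which decays exponentially. It is applied to the nonlinear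
  system itself: the extended kernel may jump at \<open>\<eta>\<close>, so the field is only Lipschitz continuous. Global solutions near
  the equilibrium come from the Picard theorem for the field frozen outside a small box.\<close>

section \<open>Global solutions of Lipschitz differential equations\<close>

text \<open>\<open>picard_global\<close> works in a Banach space, and it is later applied in the
  bounded functions on \<open>nat discrete\<close>.\<close>

instance bcontfun :: (metric_space, banach) banach ..

text \<open>In the supremum norm of \<open>exp (- 2 k t) (y t - y\<^sub>0)\<close> the Picard operator is a contraction with factor
  \<open>1 / 2\<close> on the whole half-line, so no continuation argument is needed.\<close>

lemma picard_global:
  fixes F :: "'a::banach \<Rightarrow> 'a"
  assumes lip: "K-lipschitz_on UNIV F"
  obtains y where "y 0 = y0"
    and "\<And>t. 0 \<le> t \<Longrightarrow> (y has_vector_derivative F (y t)) (at t within {0..})"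
proof -
  \<comment> \<open>Adding 1 keeps \<open>k\<close> positive even if \<open>K = 0\<close>, as
    \<open>2 * k\<close> becomes a denominator.\<close>
  define k where "k = K + 1"
  have k: "k > 0"
    using lipschitz_on_nonneg[OF lip] by (simp add: k_def)
  have Flip: "norm (F x - F y) \<le> k * norm (x - y)" for x y
    using lipschitz_onD[OF lip, of x y] by (simp add: k_def dist_norm algebra_simps add_increasing)
  have Fcont: "continuous_on S (\<lambda>s. F (f s))" if "continuous_on S f" for S and f :: "real \<Rightarrow> 'a"
    by (rule continuous_on_compose2[OF lipschitz_on_continuous_on[OF lip] that]) auto
  \<comment> \<open>Facts on integrals hold on compact intervals; this localisation carries them to
    the half-line.\<close>
  have at_within_Icc: "at s within {0..s+1} = at s within {0..}" for s :: real
    by (rule at_within_nhd[of _ "{..<s+1}"]) auto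
  \<comment> \<open>The unknown \<open>z\<close> is the rescaled deviation from \<open>y0\<close>;
    undoing the scaling, \<open>h z\<close> is the field along the curve encoded by
    \<open>z\<close>.\<close>
  define h where "h z s = F (y0 + exp (2 * k * s) *\<^sub>R apply_bcontfun z s)" for z :: "real \<Rightarrow>\<^sub>C 'a" and s
  have h_cont: "continuous_on S (h z)" for S z
    unfolding h_def by (intro Fcont continuous_intros continuous_on_apply_bcontfun)
  have h_int: "h z integrable_on {a..b}" for z a b
    by (intro integrable_continuous_real h_cont)
  have exp_int: "((\<lambda>s. exp (2 * k * s)) has_integral (exp (2 * k * t) - 1) / (2 * k)) {0..t}"
    if "0 \<le> t" for t
  proof -
    have "((\<lambda>s. exp (2 * k * s)) has_integral exp (2 * k * t) / (2 * k) - exp (2 * k * 0) / (2 * k)) {0..t}"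
      using that k
      by (intro fundamental_theorem_of_calculus)
        (auto intro!: derivative_eq_intros simp: has_real_derivative_iff_has_vector_derivative[symmetric])
    then show ?thesis by (simp add: diff_divide_distrib)
  qed
  \<comment> \<open>The integral of \<open>k * exp (2 * k * s)\<close> is
    \<open>(exp (2 * k * t) - 1) / 2\<close>, which yields the factor 1/2. With
    \<open>B = norm (F y0)\<close> this shows that the Picard image is bounded, with
    \<open>B = 0\<close> that the operator contracts.\<close>
  have bound: "norm (exp (- 2 * k * t) *\<^sub>R I) \<le> B * t * exp (- 2 * k * t) + C / 2"
    if "0 \<le> t" "(f has_integral I) {0..t}" "0 \<le> B" "0 \<le> C"
      "\<And>s. s \<in> {0..t} \<Longrightarrow> norm (f s) \<le> B + k * (exp (2 * k * s) * C)" for f :: "real \<Rightarrow> 'a" and I t B C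
  proof -
    have g: "((\<lambda>s. B + k * (exp (2 * k * s) * C)) has_integral (B * t + k * ((exp (2 * k * t) - 1) / (2 * k) * C))) {0..t}"
      using has_integral_const_real[of B 0 t] that(1)
      by (intro has_integral_add has_integral_mult_right has_integral_mult_left exp_int)
        (auto simp: mult.commute)
    have "norm I \<le> B * t + k * ((exp (2 * k * t) - 1) / (2 * k) * C)"
      using integral_norm_bound_integral[of f "{0..t}" "\<lambda>s. B + k * (exp (2 * k * s) * C)"]
        g that(2,5) by (metis has_integral_integrable integral_unique)
    also have "\<dots> \<le> B * t + exp (2 * k * t) * (C / 2)"
      using k that(4) by (simp add: field_simps)
    finally have "exp (- 2 * k * t) * norm I \<le> exp (- 2 * k * t) * (B * t + exp (2 * k * t) * (C / 2))"
      by (intro mult_left_mono) auto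
    also have "\<dots> = B * t * exp (- 2 * k * t) + C / 2"
      by (simp add: exp_minus field_simps)
    finally show ?thesis by simp
  qed
  \<comment> \<open>Elements of the function space live on all of the reals; \<open>max 0 t\<close>
    extends the image constantly to negative times.\<close>
  define T where "T z t = (let s = max 0 t in exp (- 2 * k * s) *\<^sub>R integral {0..s} (h z))" for z t
  have T_in: "T z \<in> bcontfun" for z
  proof (rule bcontfun_normI)
    have "continuous (at s within {0..}) (\<lambda>s. integral {0..s} (h z))" if "0 \<le> s" for s
    proof -
      have "continuous_on {0..s+1} (\<lambda>s. integral {0..s} (h z))"
        by (intro indefinite_integral_continuous_1 h_int)
      then have "continuous (at s within {0..s+1}) (\<lambda>s. integral {0..s} (h z))"
        using that by (simp add: continuous_on_eq_continuous_within)
      then show ?thesis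
        by (simp add: at_within_Icc)
    qed
    then have "continuous_on {0..} (\<lambda>s. integral {0..s} (h z))"
      by (simp add: continuous_on_eq_continuous_within)
    then show "continuous_on UNIV (T z)"
      unfolding T_def Let_def
      by (intro continuous_intros continuous_on_compose2[of "{0..}" _ UNIV "max 0"]) auto
    fix t :: real
    define s where "s = max 0 t"
    have "norm (h z u) \<le> norm (F y0) + k * (exp (2 * k * u) * norm z)" for u
    proof -
      have "norm (h z u) \<le> norm (F y0) + norm (h z u - F y0)"
        by (metis norm_triangle_sub)
      also have "norm (h z u - F y0) \<le> k * norm (exp (2 * k * u) *\<^sub>R z u)"
        unfolding h_def using Flip[of "y0 + exp (2 * k * u) *\<^sub>R z u" y0] by simp
      also have "\<dots> \<le> k * (exp (2 * k * u) * norm z)"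
        using k norm_bounded[of z u] by (auto intro!: mult_left_mono)
      finally show ?thesis by simp
    qed
    then have "norm (T z t) \<le> norm (F y0) * s * exp (- 2 * k * s) + norm z / 2"
      unfolding T_def Let_def s_def[symmetric]
      by (intro bound[of s "h z"] integrable_integral h_int) (auto simp: s_def)
    also have "s * exp (- 2 * k * s) \<le> 1 / (2 * k)"
    proof -
      have "2 * k * s \<le> exp (2 * k * s)"
        using exp_ge_add_one_self[of "2 * k * s"] by linarith
      then show ?thesis using k by (simp add: exp_minus field_simps)
    qed
    then have "norm (F y0) * s * exp (- 2 * k * s) + norm z / 2 \<le> norm (F y0) * (1 / (2 * k)) + norm z / 2"
      by (metis add_right_mono mult.assoc mult_left_mono norm_ge_zero)
    finally show "norm (T z t) \<le> norm (F y0) * (1 / (2 * k)) + norm z / 2" .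
  qed
  have T_eq: "apply_bcontfun (Bcontfun (T z)) = T z" for z
    by (simp add: Bcontfun_inverse T_in)
  have "dist (Bcontfun (T z1)) (Bcontfun (T z2)) \<le> 1 / 2 * dist z1 z2" for z1 z2
  proof (rule dist_bound, unfold T_eq)
    fix t :: real
    define s where "s = max 0 t"
    have "T z1 t - T z2 t = exp (- 2 * k * s) *\<^sub>R integral {0..s} (\<lambda>u. h z1 u - h z2 u)"
      unfolding T_def Let_def s_def[symmetric]
      by (simp add: Henstock_Kurzweil_Integration.integral_diff h_int scaleR_diff_right)
    moreover have "norm (h z1 u - h z2 u) \<le> 0 + k * (exp (2 * k * u) * dist z1 z2)" for u
    proof -
      have "norm (h z1 u - h z2 u) \<le> k * norm (exp (2 * k * u) *\<^sub>R (z1 u - z2 u))"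
        unfolding h_def using Flip[of "y0 + exp (2 * k * u) *\<^sub>R z1 u" "y0 + exp (2 * k * u) *\<^sub>R z2 u"]
        by (simp add: scaleR_diff_right)
      also have "\<dots> \<le> k * (exp (2 * k * u) * dist z1 z2)"
        using k dist_bounded[of z1 u z2] by (auto intro!: mult_left_mono simp: dist_norm)
      finally show ?thesis by simp
    qed
    then have "norm (exp (- 2 * k * s) *\<^sub>R integral {0..s} (\<lambda>u. h z1 u - h z2 u))
        \<le> 0 * s * exp (- 2 * k * s) + dist z1 z2 / 2"
      by (intro bound[of s "\<lambda>u. h z1 u - h z2 u"] integrable_integral integrable_diff h_int)
        (auto simp: s_def)
    ultimately show "dist (T z1 t) (T z2 t) \<le> 1 / 2 * dist z1 z2"
      by (simp add: dist_norm)
  qed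
  then obtain z where "Bcontfun (T z) = z"
    using banach_fix_type[of "1/2" "\<lambda>z. Bcontfun (T z)"] by auto
  then have z: "T z = apply_bcontfun z"
    by (metis T_eq)
  define y where "y t = y0 + integral {0..t} (h z)" for t
  \<comment> \<open>At the fixed point the scaling cancels, so the argument of \<open>F\<close>
    inside \<open>h\<close> is \<open>y t\<close> itself and the definition of \<open>y\<close>
    becomes the integral equation.\<close>
  have "h z t = F (y t)" if "0 \<le> t" for t
  proof -
    have "exp (2 * k * t) *\<^sub>R z t = integral {0..t} (h z)"
      unfolding z[symmetric] T_def using that by (simp add: exp_add[symmetric])
    then show ?thesis by (simp add: h_def y_def)
  qed
  moreover have "(y has_vector_derivative h z t) (at t within {0..})" if "0 \<le> t" for t
  proof -
    have "(y has_vector_derivative h z t) (at t within {0..t+1})"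
      unfolding y_def
      by (rule derivative_eq_intros integral_has_vector_derivative h_cont | use that in force)+
    then show ?thesis by (simp add: at_within_Icc)
  qed
  ultimately show ?thesis
    using that[of y] by (simp add: y_def)
qed

section \<open>Lyapunov functions\<close>

definition weighted_sq :: "nat \<Rightarrow> (nat \<Rightarrow> real) \<Rightarrow> (nat \<Rightarrow> real) \<Rightarrow> (nat \<Rightarrow> real) \<Rightarrow> real" where
  "weighted_sq N a p z = (\<Sum>i<N. a i * (z i - p i)\<^sup>2)"

lemma near_mono: "near N r y p \<Longrightarrow> r \<le> s \<Longrightarrow> near N s y p"
  unfolding near_def by (auto intro: less_le_trans)

lemma sq_le_weighted_sq:
  assumes "\<And>i. i < N \<Longrightarrow> 1 \<le> a i" and "i < N"
  shows "(z i - p i)\<^sup>2 \<le> weighted_sq N a p z"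
proof -
  have nonneg: "0 \<le> a k * (z k - p k)\<^sup>2" if "k < N" for k
    using assms(1)[OF that] by simp
  have "1 * (z i - p i)\<^sup>2 \<le> a i * (z i - p i)\<^sup>2"
    using assms by (intro mult_right_mono) auto
  also have "\<dots> \<le> weighted_sq N a p z"
    unfolding weighted_sq_def using assms(2) nonneg by (intro member_le_sum) auto
  finally show ?thesis by simp
qed

lemma near_if_weighted_sq_less:
  assumes "\<And>i. i < N \<Longrightarrow> 1 \<le> a i" and "0 < r" and "weighted_sq N a p z < r\<^sup>2"
  shows "near N r z p"
  unfolding near_def
proof (intro allI impI)
  fix i assume "i < N"
  then have "\<bar>z i - p i\<bar>\<^sup>2 < r\<^sup>2"
    using sq_le_weighted_sq[of N a i z p] assms by simp
  then show "\<bar>z i - p i\<bar> < r"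
    using \<open>0 < r\<close> by (rule power_less_imp_less_base[OF _ less_imp_le])
qed

text \<open>With \<open>A = sum a {..<N}\<close> and \<open>d = e / (A + 1)\<close> the sum is at
  most \<open>A * d\<^sup>2\<close>, which is below \<open>(A + 1)\<^sup>2 * d\<^sup>2\<close>. The
  added 1 makes the estimate strict and covers \<open>N = 0\<close>.\<close>

lemma weighted_sq_less_if_near:
  assumes "\<And>i. i < N \<Longrightarrow> 1 \<le> a i" and "0 < e" and "near N (e / (sum a {..<N} + 1)) z p"
  shows "weighted_sq N a p z < e\<^sup>2"
proof -
  define A where "A = sum a {..<N}"
  have "0 \<le> A"
    unfolding A_def using assms(1) by (intro sum_nonneg) force
  define d where "d = e / (A + 1)"
  have "d > 0" "e = (A + 1) * d"
    using \<open>0 \<le> A\<close> \<open>0 < e\<close> by (simp_all add: d_def)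
  have "weighted_sq N a p z \<le> (\<Sum>i<N. a i * d\<^sup>2)"
    unfolding weighted_sq_def
  proof (intro sum_mono mult_left_mono)
    fix i assume "i \<in> {..<N}"
    then have "\<bar>z i - p i\<bar> \<le> d" "0 \<le> a i"
      using assms(1)[of i] assms(3) by (force simp: near_def d_def A_def)+
    then show "(z i - p i)\<^sup>2 \<le> d\<^sup>2" "0 \<le> a i"
      using power_mono[of "\<bar>z i - p i\<bar>" d 2] by simp_all
  qed
  also have "\<dots> = A * d\<^sup>2"
    by (simp add: A_def sum_distrib_right)
  also have "\<dots> < (A + 1)\<^sup>2 * d\<^sup>2"
    using \<open>0 \<le> A\<close> \<open>0 < d\<close> by (intro mult_strict_right_mono) (auto simp: power2_eq_square algebra_simps add_strict_increasing)
  finally show ?thesis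
    by (simp add: \<open>e = _\<close> power_mult_distrib)
qed

text \<open>Dissipation is known only in the ball of radius \<open>r\<close>, so the trajectory must
  first be confined to it. At a first time with \<open>weighted_sq\<close> at least
  \<open>r\<^sup>2\<close> the decay up to that time would already give a smaller value.
  \<open>T\<close> may be finite.\<close>

lemma weighted_sq_decay:
  assumes sol: "ode_solution N D F T y"
    and a: "\<And>i. i < N \<Longrightarrow> 1 \<le> a i" and "0 < r" and "0 \<le> \<kappa>"
    and diss: "\<And>z. near N r z p \<Longrightarrow>
      (\<Sum>i<N. a i * ((z i - p i) * F z i)) \<le> - \<kappa> * weighted_sq N a p z"
    and init: "weighted_sq N a p (y 0) < r\<^sup>2"
    and t: "0 \<le> t" "ereal t < T"
  shows "weighted_sq N a p (y t) \<le> weighted_sq N a p (y 0) * exp (- 2 * \<kappa> * t)"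
proof -
  define V where "V s = weighted_sq N a p (y s)" for s
  have V_nonneg: "0 \<le> V s" for s
    unfolding V_def weighted_sq_def using a by (intro sum_nonneg mult_nonneg_nonneg) force+
  have sub: "{0..s} \<subseteq> {s. 0 \<le> s \<and> ereal s < T}" if "s \<le> t" for s
    using t that by (force intro: le_less_trans[of _ "ereal t"])
  have y_cont: "continuous_on {0..s} (\<lambda>s. y s i)" if "s \<le> t" "i < N" for i s
    using sol that sub[of s] by (auto simp: ode_solution_def intro: continuous_on_subset)
  have V_cont: "continuous_on {0..s} V" if "s \<le> t" for s
    unfolding V_def weighted_sq_def using y_cont that by (intro continuous_intros) auto
  have decay: "V s \<le> V 0 * exp (- 2 * \<kappa> * s)"
    if s: "0 \<le> s" "s \<le> t" and before: "\<And>u. 0 < u \<Longrightarrow> u < s \<Longrightarrow> near N r (y u) p" for s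
  proof -
    have "V s * exp (2 * \<kappa> * s) \<le> V 0 * exp (2 * \<kappa> * 0)"
    \<comment> \<open>The open version fits, since \<open>ode_solution\<close> gives only continuity
      at time 0.\<close>
    proof (rule DERIV_nonpos_imp_decreasing_open[OF s(1)])
      fix u assume u: "0 < u" "u < s"
      then have "ereal u < T"
        using s t by (auto intro: le_less_trans[of _ "ereal t"])
      have yd: "((\<lambda>s. y s i) has_real_derivative F (y u) i) (at u)" if "i < N" for i
        using sol u \<open>ereal u < T\<close> that by (simp add: ode_solution_def)
      define S where "S = (\<Sum>i<N. a i * ((y u i - p i) * F (y u) i))"
      have "(V has_real_derivative (\<Sum>i<N. a i * (2 * (y u i - p i) * F (y u) i))) (at u)"
        unfolding V_def weighted_sq_def
      proof (rule DERIV_sum)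
        fix i assume "i \<in> {..<N}"
        then show "((\<lambda>s. a i * (y s i - p i)\<^sup>2) has_real_derivative a i * (2 * (y u i - p i) * F (y u) i)) (at u)"
          by (auto intro!: derivative_eq_intros yd simp: algebra_simps)
      qed
      also have "(\<Sum>i<N. a i * (2 * (y u i - p i) * F (y u) i)) = 2 * S"
        unfolding S_def sum_distrib_left by (intro sum.cong) (auto simp: mult.assoc mult.left_commute mult.commute)
      finally have "((\<lambda>s. V s * exp (2 * \<kappa> * s)) has_real_derivative
          (2 * S + 2 * \<kappa> * V u) * exp (2 * \<kappa> * u)) (at u)"
        by (auto intro!: derivative_eq_intros simp: algebra_simps)
      moreover have "S \<le> - \<kappa> * V u"
        unfolding S_def V_def using diss[OF before[OF u]] .
      then have "(2 * S + 2 * \<kappa> * V u) * exp (2 * \<kappa> * u) \<le> 0"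
        by (intro mult_nonpos_nonneg) auto
      ultimately show "\<exists>d. ((\<lambda>s. V s * exp (2 * \<kappa> * s)) has_real_derivative d) (at u) \<and> d \<le> 0"
        by blast
    next
      show "continuous_on {0..s} (\<lambda>s. V s * exp (2 * \<kappa> * s))"
        by (intro continuous_intros V_cont s)
    qed
    then show ?thesis
      by (simp add: exp_minus field_simps)
  qed
  have "V s < r\<^sup>2" if s: "s \<in> {0..t}" for s
  proof (rule ccontr)
    \<comment> \<open>The times at which the level \<open>r\<^sup>2\<close> is reached form a closed
      set, so its infimum \<open>s0\<close> is attained and the trajectory is in the ball before
      \<open>s0\<close>.\<close>
    define S where "S = {s \<in> {0..t}. V s \<in> {r\<^sup>2..}}"
    assume "\<not> V s < r\<^sup>2"
    then have "S \<noteq> {}"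
      using s by (auto simp: S_def)
    have "closed S"
      unfolding S_def by (intro continuous_closed_preimage[unfolded vimage_def Int_def mem_Collect_eq, simplified] V_cont) auto
    define s0 where "s0 = Inf S"
    have bdd: "bdd_below S"
      by (auto simp: S_def intro: bdd_belowI[of _ 0])
    then have "s0 \<in> S"
      unfolding s0_def using \<open>S \<noteq> {}\<close> \<open>closed S\<close> by (intro closed_contains_Inf)
    then have s0: "0 \<le> s0" "s0 \<le> t" "r\<^sup>2 \<le> V s0"
      by (auto simp: S_def)
    have "near N r (y u) p" if "0 < u" "u < s0" for u
    proof -
      have "u \<notin> S"
        using cInf_lower[OF _ bdd, of u] that by (auto simp: s0_def)
      then show ?thesis
        using that s0 \<open>0 < r\<close>
        by (intro near_if_weighted_sq_less[OF a]) (auto simp: S_def V_def)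
    qed
    then have "V s0 \<le> V 0 * exp (- 2 * \<kappa> * s0)"
      using s0 by (intro decay) auto
    also have "\<dots> \<le> V 0 * 1"
      using V_nonneg s0 \<open>0 \<le> \<kappa>\<close> by (intro mult_left_mono) auto
    also have "\<dots> < r\<^sup>2"
      using init by (simp add: V_def)
    finally show False using s0 by simp
  qed
  then have "near N r (y u) p" if "0 < u" "u < t" for u
    using that \<open>0 < r\<close> by (intro near_if_weighted_sq_less[OF a]) (auto simp: V_def)
  then show ?thesis
    using decay[of t] t by (simp add: V_def)
qed

section \<open>Local Lipschitz continuity\<close>

text \<open>The common bound \<open>d\<close> replaces the maximum norm of the first
  \<open>N\<close> coordinates. Taking \<open>d = 0\<close> shows that on the ball \<open>f\<close>
  cannot depend on any other coordinate. No sign of \<open>K\<close> is demanded.\<close>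

definition near_lipschitz :: "nat \<Rightarrow> real \<Rightarrow> (nat \<Rightarrow> real) \<Rightarrow> ((nat \<Rightarrow> real) \<Rightarrow> real) \<Rightarrow> bool" where
  "near_lipschitz N r p f \<longleftrightarrow>
     (\<exists>K. \<forall>y z d. near N r y p \<longrightarrow> near N r z p \<longrightarrow> (\<forall>k<N. \<bar>y k - z k\<bar> \<le> d) \<longrightarrow> \<bar>f y - f z\<bar> \<le> K * d)"

lemma near_lipschitzI:
  assumes "\<And>y z d. near N r y p \<Longrightarrow> near N r z p \<Longrightarrow> (\<And>k. k < N \<Longrightarrow> \<bar>y k - z k\<bar> \<le> d) \<Longrightarrow>
    \<bar>f y - f z\<bar> \<le> K * d"
  shows "near_lipschitz N r p f"
  unfolding near_lipschitz_def using assms by (intro exI[of _ K] allI impI) simp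

lemma near_lipschitz_cong:
  assumes "\<And>y. near N r y p \<Longrightarrow> f y = g y"
  shows "near_lipschitz N r p f \<longleftrightarrow> near_lipschitz N r p g"
  unfolding near_lipschitz_def using assms by simp

lemma near_lipschitz_coord: "i < N \<Longrightarrow> near_lipschitz N r p (\<lambda>y. y i)"
  by (rule near_lipschitzI[where K = 1]) simp

lemma near_lipschitz_const: "near_lipschitz N r p (\<lambda>y. c)"
  by (rule near_lipschitzI[where K = 0]) simp

lemma near_lipschitz_add:
  assumes "near_lipschitz N r p f" and "near_lipschitz N r p g"
  shows "near_lipschitz N r p (\<lambda>y. f y + g y)"
proof -
  obtain K where K: "\<And>y z d. near N r y p \<Longrightarrow> near N r z p \<Longrightarrow>
      (\<And>k. k < N \<Longrightarrow> \<bar>y k - z k\<bar> \<le> d) \<Longrightarrow> \<bar>f y - f z\<bar> \<le> K * d"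
    using assms(1) unfolding near_lipschitz_def by blast
  obtain K' where K': "\<And>y z d. near N r y p \<Longrightarrow> near N r z p \<Longrightarrow>
      (\<And>k. k < N \<Longrightarrow> \<bar>y k - z k\<bar> \<le> d) \<Longrightarrow> \<bar>g y - g z\<bar> \<le> K' * d"
    using assms(2) unfolding near_lipschitz_def by blast
  show ?thesis
  proof (rule near_lipschitzI[where K = "K + K'"])
    fix y z d
    assume "near N r y p" "near N r z p" "\<And>k. k < N \<Longrightarrow> \<bar>y k - z k\<bar> \<le> d"
    then have "\<bar>f y - f z\<bar> \<le> K * d" "\<bar>g y - g z\<bar> \<le> K' * d"
      using K K' by blast+
    then show "\<bar>f y + g y - (f z + g z)\<bar> \<le> (K + K') * d"
      by (simp add: distrib_right)
  qed
qed

lemma near_lipschitz_sum: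
  "(\<And>i. i \<in> A \<Longrightarrow> near_lipschitz N r p (f i)) \<Longrightarrow> near_lipschitz N r p (\<lambda>y. \<Sum>i\<in>A. f i y)"
  by (induction A rule: infinite_finite_induct)
    (auto intro: near_lipschitz_add near_lipschitz_const)

text \<open>The set \<open>S\<close> is there because the outer functions used later are controlled
  only on a half-line or an interval.\<close>

lemma near_lipschitz_compose:
  assumes "near_lipschitz N r p f" and "\<And>y. near N r y p \<Longrightarrow> f y \<in> S" and "0 \<le> C"
    and \<phi>: "\<And>a b. a \<in> S \<Longrightarrow> b \<in> S \<Longrightarrow> \<bar>\<phi> a - \<phi> b\<bar> \<le> C * \<bar>a - b\<bar>"
  shows "near_lipschitz N r p (\<lambda>y. \<phi> (f y))"
proof -
  obtain K where K: "\<And>y z d. near N r y p \<Longrightarrow> near N r z p \<Longrightarrow>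
      (\<And>k. k < N \<Longrightarrow> \<bar>y k - z k\<bar> \<le> d) \<Longrightarrow> \<bar>f y - f z\<bar> \<le> K * d"
    using assms(1) unfolding near_lipschitz_def by blast
  show ?thesis
  proof (rule near_lipschitzI[where K = "C * K"])
    fix y z d
    assume yz: "near N r y p" "near N r z p" "\<And>k. k < N \<Longrightarrow> \<bar>y k - z k\<bar> \<le> d"
    have "\<bar>\<phi> (f y) - \<phi> (f z)\<bar> \<le> C * \<bar>f y - f z\<bar>"
      using yz assms(2) by (intro \<phi>)
    also have "\<dots> \<le> C * (K * d)"
      using K[OF yz] \<open>0 \<le> C\<close> by (intro mult_left_mono)
    finally show "\<bar>\<phi> (f y) - \<phi> (f z)\<bar> \<le> C * K * d" by simp
  qed
qed

lemma near_lipschitz_diff: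
  assumes "near_lipschitz N r p f" and "near_lipschitz N r p g"
  shows "near_lipschitz N r p (\<lambda>y. f y - g y)"
  using near_lipschitz_add[OF assms(1) near_lipschitz_compose[OF assms(2), of UNIV 1 uminus]] by simp

text \<open>Comparison with the centre \<open>p\<close> costs at most \<open>K * r\<close>. The
  product rule needs this bound.\<close>

lemma near_lipschitz_bounded:
  assumes "near_lipschitz N r p f" and "0 < r"
  obtains B where "\<And>y. near N r y p \<Longrightarrow> \<bar>f y\<bar> \<le> B"
proof -
  obtain K where K: "\<And>y z d. near N r y p \<Longrightarrow> near N r z p \<Longrightarrow>
      (\<And>k. k < N \<Longrightarrow> \<bar>y k - z k\<bar> \<le> d) \<Longrightarrow> \<bar>f y - f z\<bar> \<le> K * d"
    using assms(1) unfolding near_lipschitz_def by blast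
  have "\<bar>f y\<bar> \<le> \<bar>f p\<bar> + K * r" if "near N r y p" for y
  proof -
    have "\<bar>f y - f p\<bar> \<le> K * r"
      by (rule K[OF that]) (use that \<open>0 < r\<close> in \<open>auto simp: near_def less_imp_le\<close>)
    then show ?thesis by linarith
  qed
  then show ?thesis using that by blast
qed

lemma near_lipschitz_mult:
  assumes "near_lipschitz N r p f" and "near_lipschitz N r p g" and "0 < r"
  shows "near_lipschitz N r p (\<lambda>y. f y * g y)"
proof -
  obtain K where K: "\<And>y z d. near N r y p \<Longrightarrow> near N r z p \<Longrightarrow>
      (\<And>k. k < N \<Longrightarrow> \<bar>y k - z k\<bar> \<le> d) \<Longrightarrow> \<bar>f y - f z\<bar> \<le> K * d"
    using assms(1) unfolding near_lipschitz_def by blast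
  obtain K' where K': "\<And>y z d. near N r y p \<Longrightarrow> near N r z p \<Longrightarrow>
      (\<And>k. k < N \<Longrightarrow> \<bar>y k - z k\<bar> \<le> d) \<Longrightarrow> \<bar>g y - g z\<bar> \<le> K' * d"
    using assms(2) unfolding near_lipschitz_def by blast
  obtain B where B: "\<And>y. near N r y p \<Longrightarrow> \<bar>f y\<bar> \<le> B"
    using near_lipschitz_bounded[OF assms(1,3)] by blast
  obtain B' where B': "\<And>y. near N r y p \<Longrightarrow> \<bar>g y\<bar> \<le> B'"
    using near_lipschitz_bounded[OF assms(2,3)] by blast
  show ?thesis
  proof (rule near_lipschitzI[where K = "B * K' + B' * K"])
    fix y z d
    assume yz: "near N r y p" "near N r z p" "\<And>k. k < N \<Longrightarrow> \<bar>y k - z k\<bar> \<le> d"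
    have "f y * g y - f z * g z = f y * (g y - g z) + g z * (f y - f z)"
      by (simp add: algebra_simps)
    then have "\<bar>f y * g y - f z * g z\<bar> \<le> \<bar>f y\<bar> * \<bar>g y - g z\<bar> + \<bar>g z\<bar> * \<bar>f y - f z\<bar>"
      by (metis abs_mult abs_triangle_ineq)
    also have "\<dots> \<le> B * (K' * d) + B' * (K * d)"
      using B[OF yz(1)] B'[OF yz(2)] K[OF yz] K'[OF yz] by (intro add_mono mult_mono') auto
    finally show "\<bar>f y * g y - f z * g z\<bar> \<le> (B * K' + B' * K) * d"
      by (simp add: algebra_simps)
  qed
qed

section \<open>Stability from dissipation\<close>

text \<open>As \<open>N\<close> is a term, there is no type of vectors of dimension \<open>N\<close>; the equation is solved in
  the Banach space of bounded functions on \<open>nat discrete\<close>, which contains all dimensions \<open>N\<close>. The map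
  \<open>c\<close> is meant to be a retraction onto a box.\<close>

lemma ode_solution_clamped_exists:
  assumes lip: "\<And>i. i < N \<Longrightarrow> near_lipschitz N r p (\<lambda>y. F y i)"
    and c: "\<And>y. near N r (c y) p" "\<And>y z k. \<bar>c y k - c z k\<bar> \<le> \<bar>y k - z k\<bar>"
  shows "\<exists>y. ode_solution N UNIV (\<lambda>y. F (c y)) \<infinity> y \<and> (\<forall>i<N. y 0 i = y0 i)"
proof -
  have "\<exists>K. \<forall>i<N. \<forall>y z d. near N r y p \<longrightarrow> near N r z p \<longrightarrow>
      (\<forall>k<N. \<bar>y k - z k\<bar> \<le> d) \<longrightarrow> \<bar>F y i - F z i\<bar> \<le> K i * d"
    using lip unfolding near_lipschitz_def by (intro choice) blast
  then obtain K where K: "\<And>i y z d. i < N \<Longrightarrow> near N r y p \<Longrightarrow> near N r z p \<Longrightarrow>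
      (\<And>k. k < N \<Longrightarrow> \<bar>y k - z k\<bar> \<le> d) \<Longrightarrow> \<bar>F y i - F z i\<bar> \<le> K i * d"
    by blast
  have trunc: "(\<lambda>n. if of_discrete n < N then f (of_discrete n) else 0) \<in> bcontfun" for f :: "nat \<Rightarrow> real"
  proof (rule bcontfun_normI[of _ "\<Sum>i<N. \<bar>f i\<bar>"])
    fix n :: "nat discrete"
    show "norm (if of_discrete n < N then f (of_discrete n) else 0) \<le> (\<Sum>i<N. \<bar>f i\<bar>)"
      using member_le_sum[of "of_discrete n" "{..<N}" "\<lambda>i. \<bar>f i\<bar>"] by (auto simp: sum_nonneg)
  qed (simp add: continuous_on_open_vimage open_discrete)
  \<comment> \<open>\<open>E\<close> embeds the first \<open>N\<close> coordinates and fills up with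
    zeros, which makes the result bounded; \<open>P\<close> below reads coordinates back.\<close>
  define E where "E f = Bcontfun (\<lambda>n. if of_discrete n < N then f (of_discrete n) else 0)" for f :: "nat \<Rightarrow> real"
  have E: "apply_bcontfun (E f) n = (if of_discrete n < N then f (of_discrete n) else 0)" for f n
    by (simp add: E_def Bcontfun_inverse trunc)
  define P where "P z i = apply_bcontfun z (discrete i)" for z :: "nat discrete \<Rightarrow>\<^sub>C real" and i
  have PE: "P (E f) i = f i" if "i < N" for f i
    using that by (simp add: P_def E discrete_inverse)
  \<comment> \<open>The sum of absolute values dominates every \<open>K i\<close> and is
    nonnegative, although the \<open>K i\<close> carry no sign.\<close>
  have "(\<Sum>i<N. \<bar>K i\<bar>)-lipschitz_on UNIV (\<lambda>z. E (F (c (P z))))"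
  proof (rule lipschitz_onI)
    fix x z :: "nat discrete \<Rightarrow>\<^sub>C real"
    show "dist (E (F (c (P x)))) (E (F (c (P z)))) \<le> (\<Sum>i<N. \<bar>K i\<bar>) * dist x z"
    proof (rule dist_bound)
      fix n :: "nat discrete"
      define i where "i = of_discrete n"
      show "dist (E (F (c (P x))) n) (E (F (c (P z))) n) \<le> (\<Sum>i<N. \<bar>K i\<bar>) * dist x z"
      proof (cases "i < N")
        case True
        have "\<bar>c (P x) k - c (P z) k\<bar> \<le> dist x z" for k
          using c(2)[of "P x" k "P z"] dist_bounded[of x "discrete k" z] by (simp add: P_def dist_real_def)
        then have "\<bar>F (c (P x)) i - F (c (P z)) i\<bar> \<le> K i * dist x z"
          using True by (intro K c)
        also have "\<dots> \<le> (\<Sum>i<N. \<bar>K i\<bar>) * dist x z"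
          using True member_le_sum[of i "{..<N}" "\<lambda>i. \<bar>K i\<bar>"] by (intro mult_right_mono) auto
        finally show ?thesis using True by (simp add: E i_def dist_real_def)
      qed (simp add: E i_def sum_nonneg)
    qed
  qed (simp add: sum_nonneg)
  from picard_global[OF this, of "E y0"]
  obtain z where z0: "z 0 = E y0"
    and z: "\<And>t. 0 \<le> t \<Longrightarrow> (z has_vector_derivative E (F (c (P (z t))))) (at t within {0..})"
    by blast
  define y where "y t = P (z t)" for t
  have lin: "bounded_linear (\<lambda>z. P z i)" for i
    by (rule bounded_linear_intro[of _ 1]) (simp_all add: P_def, metis norm_bounded real_norm_def)
  have y: "((\<lambda>t. y t i) has_real_derivative F (c (y t)) i) (at t within {0..})"
    if "0 \<le> t" "i < N" for t i
    using bounded_linear.has_vector_derivative[OF lin z[OF that(1)], of i] that(2)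
    by (simp add: y_def PE has_real_derivative_iff_has_vector_derivative)
  have "((\<lambda>t. y t i) has_real_derivative F (c (y t)) i) (at t)" if "0 < t" "i < N" for t i
    using y[of t i] that by (simp add: at_within_interior[of t "{0..}"])
  moreover have "continuous_on {0..} (\<lambda>t. y t i)" if "i < N" for i
    using y[OF _ that] by (intro DERIV_continuous_on) auto
  ultimately have "ode_solution N UNIV (\<lambda>y. F (c y)) \<infinity> y"
    by (simp add: ode_solution_def atLeast_def)
  moreover have "y 0 i = y0 i" if "i < N" for i
    using that by (simp add: y_def z0 PE)
  ultimately show ?thesis by blast
qed

text \<open>Stability and attraction are read off from the exponential decay of
  \<open>weighted_sq\<close>. For existence, a solution of the clamped field that starts close
  enough never leaves the region where clamping is the identity, so it solves the original
  equation.\<close>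

theorem asymptotically_stable_if_weighted_sq_dissipative:
  assumes "0 < r" and a: "\<And>i. i < N \<Longrightarrow> 1 \<le> a i" and "0 < \<kappa>"
    and D: "\<And>y. near N r y p \<Longrightarrow> y \<in> D"
    and equilibrium: "\<And>i. i < N \<Longrightarrow> F p i = 0"
    and lip: "\<And>i. i < N \<Longrightarrow> near_lipschitz N r p (\<lambda>y. F y i)"
    and diss: "\<And>y. near N r y p \<Longrightarrow>
      (\<Sum>i<N. a i * ((y i - p i) * F y i)) \<le> - \<kappa> * weighted_sq N a p y"
  shows "asymptotically_stable N D F p"
proof -
  define \<delta> where "\<delta> e = e / (sum a {..<N} + 1)" for e
  have A: "0 \<le> sum a {..<N}"
    using a by (intro sum_nonneg) force
  then have \<delta>_pos: "0 < \<delta> e" if "0 < e" for e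
    using that by (simp add: \<delta>_def)
  have V_less: "weighted_sq N a p z < e\<^sup>2" if "near N (\<delta> e) z p" "0 < e" for z e
    using weighted_sq_less_if_near[OF a] that by (simp add: \<delta>_def)
  have V_nonneg: "0 \<le> weighted_sq N a p z" for z
    unfolding weighted_sq_def using a by (intro sum_nonneg mult_nonneg_nonneg) force+
  \<comment> \<open>Stated for any phase space \<open>D'\<close> and any field \<open>F'\<close>
    that agrees with \<open>F\<close> near \<open>p\<close>, so that it also applies to the clamped
    field.\<close>
  have decay: "weighted_sq N a p (y t) \<le> weighted_sq N a p (y 0) * exp (- 2 * \<kappa> * t)"
    if "ode_solution N D' F' T y" "0 < e" "e \<le> r" "near N (\<delta> e) (y 0) p" "0 \<le> t" "ereal t < T"
      "\<And>z. near N e z p \<Longrightarrow> F' z = F z" for D' F' T y e t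
    using that a diss[OF near_mono[OF _ \<open>e \<le> r\<close>]] \<open>0 < \<kappa>\<close> V_less[of e "y 0"]
    by (intro weighted_sq_decay[of N D' F' T y a e \<kappa> p t]) auto
  have stay: "near N e (y t) p"
    if "ode_solution N D' F' T y" "0 < e" "e \<le> r" "near N (\<delta> e) (y 0) p" "0 \<le> t" "ereal t < T"
      "\<And>z. near N e z p \<Longrightarrow> F' z = F z" for D' F' T y e t
  proof (rule near_if_weighted_sq_less[OF a \<open>0 < e\<close>])
    have "weighted_sq N a p (y t) \<le> weighted_sq N a p (y 0) * exp (- 2 * \<kappa> * t)"
      using that by (rule decay)
    also have "\<dots> \<le> weighted_sq N a p (y 0) * 1"
      using that \<open>0 < \<kappa>\<close> V_nonneg by (intro mult_left_mono) auto
    also have "\<dots> < e\<^sup>2"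
      using that V_less[of e "y 0"] by simp
    finally show "weighted_sq N a p (y t) < e\<^sup>2" .
  qed
  have mem: "p \<in> D"
    using \<open>0 < r\<close> by (intro D) (simp add: near_def)
  have "\<exists>y. ode_solution N D F \<infinity> y \<and> (\<forall>i<N. y 0 i = y0 i)"
    if y0: "near N (\<delta> (r / 2)) y0 p" for y0
  proof -
    \<comment> \<open>The closed box of radius \<open>r / 2\<close> lies inside the open ball of
      radius \<open>r\<close>. Coordinates from \<open>N\<close> on are kept, so that
      \<open>c y = y\<close> holds as an equality of functions.\<close>
    define c where "c y i = (if i < N then max (p i - r / 2) (min (p i + r / 2) (y i)) else y i)"
      for y :: "nat \<Rightarrow> real" and i
    have c_near: "near N r (c y) p" for y
      using \<open>0 < r\<close> by (auto simp: near_def c_def)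
    have c_lip: "\<bar>c y k - c z k\<bar> \<le> \<bar>y k - z k\<bar>" for y z k
      by (auto simp: c_def)
    have c_id: "c y = y" if "near N (r / 2) y p" for y
    proof
      fix i show "c y i = y i"
        using that unfolding near_def c_def by (smt (verit))
    qed
    obtain y where y: "ode_solution N UNIV (\<lambda>y. F (c y)) \<infinity> y" "\<And>i. i < N \<Longrightarrow> y 0 i = y0 i"
      using ode_solution_clamped_exists[of N r p F c y0, OF lip c_near c_lip] by blast
    have "near N (\<delta> (r / 2)) (y 0) p"
      using y0 y(2) by (simp add: near_def)
    moreover have "F (c z) = F z" if "near N (r / 2) z p" for z
      using c_id[OF that] by (rule arg_cong)
    ultimately have near: "near N (r / 2) (y t) p" if "0 \<le> t" for t
      using stay[OF y(1), of "r / 2" t] \<open>0 < r\<close> that by simp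
    have "y t \<in> D" if "0 \<le> t" for t
      using \<open>0 < r\<close> by (intro D near_mono[OF near[OF that]]) simp
    moreover have "F (c (y t)) = F (y t)" if "0 \<le> t" for t
      using c_id[OF near[OF that]] by simp
    ultimately have "ode_solution N D F \<infinity> y"
      using y(1) by (simp add: ode_solution_def)
    with y(2) show ?thesis by blast
  qed
  then have global: "\<exists>r>0. \<forall>y0. near N r y0 p \<longrightarrow> (\<exists>y. ode_solution N D F \<infinity> y \<and> (\<forall>i<N. y 0 i = y0 i))"
    using \<delta>_pos[of "r / 2"] \<open>0 < r\<close> by auto
  have lyapunov: "\<exists>\<delta>>0. \<forall>T y. ode_solution N D F T y \<and> near N \<delta> (y 0) p \<longrightarrow>
      (\<forall>t. 0 \<le> t \<and> ereal t < T \<longrightarrow> near N \<epsilon> (y t) p)" if "0 < \<epsilon>" for \<epsilon>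
  proof -
    \<comment> \<open>The radius is cut at \<open>r\<close>, beyond which no dissipation is
      known.\<close>
    have "near N \<epsilon> (y t) p"
      if "ode_solution N D F T y" "near N (\<delta> (min \<epsilon> r)) (y 0) p" "0 \<le> t" "ereal t < T" for T y t
      using stay[OF that(1), of "min \<epsilon> r" t] that \<open>0 < \<epsilon>\<close> \<open>0 < r\<close>
      by (auto elim!: near_mono)
    moreover have "0 < \<delta> (min \<epsilon> r)"
      using \<delta>_pos \<open>0 < \<epsilon>\<close> \<open>0 < r\<close> by simp
    ultimately show ?thesis by blast
  qed
  have "((\<lambda>t. y t i) \<longlongrightarrow> p i) at_top"
    if sol: "ode_solution N D F \<infinity> y" "near N (\<delta> r) (y 0) p" and "i < N" for y i
  proof -
    have "((\<lambda>t. (y t i - p i)\<^sup>2) \<longlongrightarrow> 0) at_top"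
    proof (rule tendsto_sandwich[of "\<lambda>_. 0"])
      have "(y t i - p i)\<^sup>2 \<le> weighted_sq N a p (y 0) * exp (- 2 * \<kappa> * t)" if "0 \<le> t" for t
        using sq_le_weighted_sq[of N a i "y t" p, OF a \<open>i < N\<close>] decay[OF sol(1) \<open>0 < r\<close> order_refl sol(2) that]
        by simp
      then show "\<forall>\<^sub>F t in at_top. (y t i - p i)\<^sup>2 \<le> weighted_sq N a p (y 0) * exp (- 2 * \<kappa> * t)"
        by (rule eventually_mono[OF eventually_ge_at_top[of 0]])
      have "filterlim (\<lambda>t. - 2 * \<kappa> * t) at_bot at_top"
        using filterlim_tendsto_neg_mult_at_bot[OF tendsto_const _ filterlim_ident, of "- 2 * \<kappa>"]
          \<open>0 < \<kappa>\<close> by simp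
      then have "((\<lambda>t. exp (- 2 * \<kappa> * t)) \<longlongrightarrow> 0) at_top"
        by (rule filterlim_compose[OF exp_at_bot])
      then show "((\<lambda>t. weighted_sq N a p (y 0) * exp (- 2 * \<kappa> * t)) \<longlongrightarrow> 0) at_top"
        by (rule tendsto_mult_right_zero)
    qed auto
    then have "((\<lambda>t. \<bar>y t i - p i\<bar>) \<longlongrightarrow> 0) at_top"
      using tendsto_real_sqrt by fastforce
    then show ?thesis
      by (rule LIM_zero_cancel[OF tendsto_rabs_zero_cancel])
  qed
  then have attractive: "\<exists>\<delta>>0. \<forall>y. ode_solution N D F \<infinity> y \<and> near N \<delta> (y 0) p \<longrightarrow>
      (\<forall>i<N. ((\<lambda>t. y t i) \<longlongrightarrow> p i) at_top)"
    using \<delta>_pos[OF \<open>0 < r\<close>] by (intro exI[of _ "\<delta> r"]) simp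
  show ?thesis
    unfolding asymptotically_stable_def
    by (intro conjI allI impI mem equilibrium global lyapunov attractive)
qed

text \<open>Weights growing geometrically along the chain let the damping of car \<open>k\<close> absorb the coupling
  terms it causes in all followers \<open>i < k\<close>.\<close>

lemma triangular_dissipation_weighted:
  fixes e f :: "nat \<Rightarrow> real"
  assumes "0 < c" and M: "M = 2 + 2 * real N * C\<^sup>2 / c\<^sup>2"
    and tri: "\<And>i. i < N \<Longrightarrow> e i * f i \<le> - c * (e i)\<^sup>2 + C * \<bar>e i\<bar> * (\<Sum>k\<in>{i<..<N}. \<bar>e k\<bar>)"
  shows "(\<Sum>i<N. M ^ i * (e i * f i)) \<le> - (c / 4) * (\<Sum>i<N. M ^ i * (e i)\<^sup>2)"
proof -
  \<comment> \<open>\<open>B\<close> is the coefficient that Young's inequality leaves on the gap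
    ahead; \<open>M\<close> is chosen so that \<open>B\<close> is at most
    \<open>c / 4 * (M - 1)\<close>.\<close>
  define B where "B = real N * C\<^sup>2 / (2 * c)"
  have B_eq: "B = c / 4 * (M - 2)"
    using \<open>0 < c\<close> by (simp add: B_def M field_simps power2_eq_square)
  have "1 \<le> M"
    unfolding M by simp
  \<comment> \<open>Young's inequality, weighted so that at most \<open>N\<close> cross terms
    consume half of the damping \<open>c\<close>.\<close>
  have amgm: "C * \<bar>e i\<bar> * \<bar>e k\<bar> \<le> c / (2 * real N) * (e i)\<^sup>2 + B * (e k)\<^sup>2" if "i < N" for i k
  proof -
    have "0 \<le> c / (2 * real N) * (\<bar>e i\<bar> - real N * C / c * \<bar>e k\<bar>)\<^sup>2"
      using \<open>0 < c\<close> by simp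
    also have "\<dots> = c / (2 * real N) * (e i)\<^sup>2 + B * (e k)\<^sup>2 - C * \<bar>e i\<bar> * \<bar>e k\<bar>"
      using \<open>0 < c\<close> that
      by (simp add: B_def power2_diff power_mult_distrib field_simps power2_eq_square)
    finally show ?thesis by simp
  qed
  have step: "e i * f i \<le> - (c / 2) * (e i)\<^sup>2 + (\<Sum>k\<in>{i<..<N}. B * (e k)\<^sup>2)" if "i < N" for i
  proof -
    have "C * \<bar>e i\<bar> * (\<Sum>k\<in>{i<..<N}. \<bar>e k\<bar>) \<le> (\<Sum>k\<in>{i<..<N}. c / (2 * real N) * (e i)\<^sup>2 + B * (e k)\<^sup>2)"
      unfolding sum_distrib_left using that by (intro sum_mono amgm)
    also have "\<dots> = real (card {i<..<N}) * (c / (2 * real N) * (e i)\<^sup>2) + (\<Sum>k\<in>{i<..<N}. B * (e k)\<^sup>2)"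
      by (simp add: sum.distrib)
    also have "real (card {i<..<N}) * (c / (2 * real N) * (e i)\<^sup>2) \<le> real N * (c / (2 * real N) * (e i)\<^sup>2)"
      using \<open>0 < c\<close> by (intro mult_right_mono) auto
    also have "\<dots> = c / 2 * (e i)\<^sup>2"
      using that by simp
    finally show ?thesis using tri[OF that] by simp
  qed
  \<comment> \<open>The geometric sum telescopes against \<open>M - 1\<close>: all followers
    together charge gap \<open>k\<close> at most half of its remaining damping
    \<open>c / 2\<close>.\<close>
  have geo: "B * (\<Sum>i<k. M ^ i) \<le> c / 4 * M ^ k" for k
  proof -
    have "B * (\<Sum>i<k. M ^ i) \<le> c / 4 * (M - 1) * (\<Sum>i<k. M ^ i)"
      unfolding B_eq using \<open>0 < c\<close> \<open>1 \<le> M\<close> by (intro mult_right_mono sum_nonneg) auto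
    also have "\<dots> = c / 4 * (M ^ k - 1)"
      by (simp add: power_diff_1_eq)
    also have "\<dots> \<le> c / 4 * M ^ k"
      using \<open>0 < c\<close> by simp
    finally show ?thesis .
  qed
  have "(\<Sum>i<N. M ^ i * (e i * f i)) \<le>
      (\<Sum>i<N. M ^ i * (- (c / 2) * (e i)\<^sup>2 + (\<Sum>k\<in>{i<..<N}. B * (e k)\<^sup>2)))"
    using \<open>1 \<le> M\<close> by (intro sum_mono mult_left_mono step) auto
  also have "\<dots> = - (c / 2) * (\<Sum>i<N. M ^ i * (e i)\<^sup>2) + (\<Sum>i<N. \<Sum>k\<in>{i<..<N}. M ^ i * (B * (e k)\<^sup>2))"
    by (simp add: distrib_left sum.distrib sum_distrib_left sum_negf sum_subtractf algebra_simps)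
  \<comment> \<open>Exchanging the sums books each coupling term on the gap \<open>k\<close> that
    causes it.\<close>
  also have "(\<Sum>i<N. \<Sum>k\<in>{i<..<N}. M ^ i * (B * (e k)\<^sup>2)) = (\<Sum>k<N. \<Sum>i<k. M ^ i * (B * (e k)\<^sup>2))"
    by (simp add: sum.Sigma) (rule sum.reindex_bij_witness[of _ prod.swap prod.swap]; auto)
  also have "\<dots> = (\<Sum>k<N. B * (\<Sum>i<k. M ^ i) * (e k)\<^sup>2)"
    by (intro sum.cong) (auto simp: sum_distrib_left sum_distrib_right mult_ac)
  also have "\<dots> \<le> (\<Sum>k<N. c / 4 * M ^ k * (e k)\<^sup>2)"
    by (intro sum_mono mult_right_mono geo) auto
  also have "\<dots> = c / 4 * (\<Sum>k<N. M ^ k * (e k)\<^sup>2)"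
    by (simp add: sum_distrib_left mult.assoc)
  finally show ?thesis by simp
qed

section \<open>The kernel\<close>

text \<open>The cumulative distribution function of the kernel on the half-line; the weights become
  its increments.\<close>

definition kernel_mass :: "real \<Rightarrow> (real \<Rightarrow> real) \<Rightarrow> real \<Rightarrow> real" where
  "kernel_mass \<eta> w z = integral {0..z} (kernel_ext \<eta> w)"

lemma kernel_antimono:
  assumes "kernel \<eta> w" and "0 \<le> x" "x \<le> y" "y \<le> \<eta>"
  shows "w y \<le> w x"
proof -
  obtain w' where w': "\<And>x. x \<in> {0..\<eta>} \<Longrightarrow> (w has_real_derivative w' x) (at x within {0..\<eta>})"
    "\<And>x. x \<in> {0..\<eta>} \<Longrightarrow> w' x \<le> 0"
    using assms(1) unfolding kernel_def C1_with_deriv_def by blast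
  show ?thesis
  proof (rule DERIV_nonpos_imp_decreasing_open[OF \<open>x \<le> y\<close>])
    fix u assume u: "x < u" "u < y"
    then have "(w has_real_derivative w' u) (at u)"
      using w'(1)[of u] assms by (simp add: at_within_interior[of u "{0..\<eta>}"])
    then show "\<exists>d. (w has_real_derivative d) (at u) \<and> d \<le> 0"
      using w'(2)[of u] u assms by auto
  next
    have "continuous_on {0..\<eta>} w"
      using w'(1) by (rule DERIV_continuous_on)
    then show "continuous_on {x..y} w"
      by (rule continuous_on_subset) (use assms in auto)
  qed
qed

lemma kernel_ext_bounds:
  assumes "kernel \<eta> w" and "0 < \<eta>"
  shows "0 \<le> kernel_ext \<eta> w x" and "kernel_ext \<eta> w x \<le> w 0"
  using assms kernel_antimono[OF assms(1), of 0 x] kernel_antimono[OF assms(1), of 0 0]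
  by (auto simp: kernel_ext_def kernel_def)

lemma kernel_ext_has_integral:
  assumes "kernel \<eta> w"
  shows "(kernel_ext \<eta> w has_integral 1) UNIV" and "kernel_ext \<eta> w integrable_on {a..b}"
proof -
  have "(w has_integral 1) {0..\<eta>}"
    using assms by (simp add: kernel_def)
  then show *: "(kernel_ext \<eta> w has_integral 1) UNIV"
    unfolding kernel_ext_def[abs_def] by (simp only: has_integral_restrict_UNIV)
  then show "kernel_ext \<eta> w integrable_on {a..b}"
    by (intro integrable_on_subinterval[of _ UNIV]) (auto simp: integrable_on_def)
qed

lemma kernel_mass_diff:
  assumes "kernel \<eta> w" and "0 \<le> a" "a \<le> b"
  shows "kernel_mass \<eta> w b - kernel_mass \<eta> w a = integral {a..b} (kernel_ext \<eta> w)"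
  using Henstock_Kurzweil_Integration.integral_combine[OF assms(2,3) kernel_ext_has_integral(2)[OF assms(1)]]
  by (simp add: kernel_mass_def)

lemma integral_kernel_ext_shift:
  assumes "kernel \<eta> w" and "c \<le> a" "a \<le> b"
  shows "integral {a..b} (\<lambda>y. kernel_ext \<eta> w (y - c)) = kernel_mass \<eta> w (b - c) - kernel_mass \<eta> w (a - c)"
  using integral_shift_Icc_real[of "a - c" "b - c" "\<lambda>y. kernel_ext \<eta> w (y - c)" c]
    kernel_mass_diff[OF assms(1), of "a - c" "b - c"] assms(2,3)
  by (simp add: o_def algebra_simps)

lemma kernel_mass_mono:
  assumes "kernel \<eta> w" and "0 < \<eta>" and "0 \<le> a" "a \<le> b"
  shows "kernel_mass \<eta> w a \<le> kernel_mass \<eta> w b"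
proof -
  have "0 \<le> integral {a..b} (kernel_ext \<eta> w)"
    using kernel_ext_bounds[OF assms(1,2)] kernel_ext_has_integral(2)[OF assms(1)]
    by (intro Henstock_Kurzweil_Integration.integral_nonneg) auto
  then show ?thesis
    using kernel_mass_diff[OF assms(1,3,4)] by simp
qed

text \<open>The kernel is nonincreasing, so \<open>w 0\<close> bounds it everywhere, also across a
  jump at \<open>\<eta>\<close>.\<close>

lemma kernel_mass_lipschitz:
  assumes "kernel \<eta> w" and "0 < \<eta>" and "0 \<le> a" "0 \<le> b"
  shows "\<bar>kernel_mass \<eta> w a - kernel_mass \<eta> w b\<bar> \<le> w 0 * \<bar>a - b\<bar>"
  using assms(3,4)
proof (induction a b rule: linorder_wlog)
  case (le a b)
  have "integral {a..b} (kernel_ext \<eta> w) \<le> integral {a..b} (\<lambda>_. w 0)"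
    using kernel_ext_bounds[OF assms(1,2)] kernel_ext_has_integral(2)[OF assms(1)]
    by (intro integral_le) auto
  then show ?case
    using le kernel_mass_diff[OF assms(1), of a b] kernel_mass_mono[OF assms(1,2), of a b]
    by (simp add: algebra_simps)
qed (simp add: abs_minus_commute)

lemma kernel_mass_0: "kernel_mass \<eta> w 0 = 0"
  by (simp add: kernel_mass_def)

lemma kernel_mass_eq_1:
  assumes "kernel \<eta> w" and "\<eta> \<le> z"
  shows "kernel_mass \<eta> w z = 1"
proof -
  have "(kernel_ext \<eta> w has_integral 1) {0..z}"
    unfolding kernel_ext_def[abs_def] using assms has_integral_restrict[of "{0..\<eta>}" "{0..z}" w 1]
    by (simp add: kernel_def)
  then show ?thesis
    by (simp add: kernel_mass_def integral_unique)
qed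

text \<open>For \<open>z < \<eta>\<close>, monotonicity bounds the mass on \<open>{0..z}\<close>
  below by \<open>z * w z\<close>. If \<open>w z = 0\<close>, there is no mass beyond
  \<open>z\<close>, so all of it lies on \<open>{0..z}\<close>.\<close>

lemma kernel_mass_pos:
  assumes "kernel \<eta> w" and "0 < \<eta>" and "0 < z"
  shows "0 < kernel_mass \<eta> w z"
proof (cases "\<eta> \<le> z")
  case True
  then show ?thesis using kernel_mass_eq_1[OF assms(1)] by simp
next
  case False
  have "z * w z = integral {0..z} (\<lambda>_. w z)"
    using assms(3) by simp
  also have "\<dots> \<le> kernel_mass \<eta> w z"
    unfolding kernel_mass_def
    using kernel_antimono[OF assms(1), of _ z] False kernel_ext_has_integral(2)[OF assms(1)]
    by (intro integral_le) (auto simp: kernel_ext_def)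
  finally have low: "z * w z \<le> kernel_mass \<eta> w z" .
  have "1 - kernel_mass \<eta> w z = integral {z..\<eta>} (kernel_ext \<eta> w)"
    using kernel_mass_diff[OF assms(1), of z \<eta>] kernel_mass_eq_1[OF assms(1), of \<eta>] False assms(3) by simp
  also have "\<dots> \<le> integral {z..\<eta>} (\<lambda>_. w z)"
    using kernel_antimono[OF assms(1), of z] False assms(3) kernel_ext_has_integral(2)[OF assms(1)]
    by (intro integral_le) (auto simp: kernel_ext_def)
  also have "\<dots> = (\<eta> - z) * w z"
    using False by simp
  finally have high: "1 - kernel_mass \<eta> w z \<le> (\<eta> - z) * w z" .
  show ?thesis
  proof (cases "w z = 0")
    case False
    moreover have "0 \<le> w z"
      using assms \<open>\<not> \<eta> \<le> z\<close> by (simp add: kernel_def)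
    ultimately have "0 < z * w z"
      using assms(3) by simp
    then show ?thesis using low by simp
  qed (use high in simp)
qed

section \<open>The velocity law\<close>

text \<open>As a function of the gap the speed has derivative
  \<open>- f' \<rho> / (n * y\<^sup>2)\<close>, which lies between two constants near
  \<open>L\<close>; the mean value theorem turns this into strong monotonicity and a Lipschitz
  bound.\<close>

lemma congestion_law_bounds:
  fixes f f' :: "real \<Rightarrow> real" and n L R \<mu> :: real
  assumes C1: "C1_with_deriv f f' {0..R}" and "0 < \<mu>"
    and f': "\<And>\<rho>. \<rho> \<in> {0..R} \<Longrightarrow> f' \<rho> \<le> - \<mu>"
    and "0 < n" "0 < L" "1 / (n * L) < R"
  shows "\<exists>r m K. 0 < r \<and> r \<le> L / 2 \<and> 0 < m \<and> 0 \<le> K \<and>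
    (\<forall>y z. \<bar>y - L\<bar> < r \<longrightarrow> \<bar>z - L\<bar> < r \<longrightarrow>
      m * (y - z)\<^sup>2 \<le> (y - z) * (f (1 / (n * y)) - f (1 / (n * z))) \<and>
      \<bar>f (1 / (n * y)) - f (1 / (n * z))\<bar> \<le> K * \<bar>y - z\<bar>)"
proof -
  define h where "h y = f (1 / (n * y))" for y
  have "0 < 1 / (n * L)"
    using \<open>0 < n\<close> \<open>0 < L\<close> by simp
  then have "0 < R"
    using \<open>1 / (n * L) < R\<close> by linarith
  \<comment> \<open>The first entry keeps the gap away from 0, the second keeps the density below
    \<open>R\<close>, where \<open>f\<close> has a two-sided derivative.\<close>
  define r where "r = min (L / 2) (L - 1 / (n * R))"
  have "1 / (n * R) < L"
    using assms(4-6) \<open>0 < R\<close> by (simp add: field_simps)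
  then have r: "0 < r" "r \<le> L / 2" "r \<le> L - 1 / (n * R)"
    unfolding r_def using \<open>0 < L\<close> by simp (rule min.cobounded1 min.cobounded2)+
  have "compact (f' ` {0..R})"
    using C1 by (intro compact_continuous_image) (auto simp: C1_with_deriv_def)
  then obtain B where B: "\<And>\<rho>. \<rho> \<in> {0..R} \<Longrightarrow> \<bar>f' \<rho>\<bar> \<le> B"
    by (force dest: compact_imp_bounded simp: bounded_iff)
  have "0 \<le> B"
    using B[of 0] \<open>0 < R\<close> by auto
  \<comment> \<open>\<open>m\<close> and \<open>K\<close> come from the extreme gaps
    \<open>2 * L\<close> and \<open>L / 2\<close>.\<close>
  define m where "m = \<mu> / (n * (2 * L)\<^sup>2)"
  define K where "K = B / (n * (L / 2)\<^sup>2)"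
  define h' where "h' y = - f' (1 / (n * y)) / (n * y\<^sup>2)" for y
  have h: "(h has_real_derivative h' y) (at y)" "m \<le> h' y" "h' y \<le> K" if "\<bar>y - L\<bar> < r" for y
  proof -
    have y: "L / 2 < y" "y < 2 * L" "1 / (n * R) < y"
      using that r by linarith+
    then have "0 < y" using \<open>0 < L\<close> by linarith
    define \<rho> where "\<rho> = 1 / (n * y)"
    have \<rho>: "0 < \<rho>" "\<rho> < R"
      using \<open>0 < y\<close> \<open>0 < n\<close> y(3) \<open>0 < R\<close> by (auto simp: \<rho>_def field_simps)
    have "(f has_real_derivative f' \<rho>) (at \<rho>)"
      using C1 \<rho> by (auto simp: C1_with_deriv_def at_within_interior[of \<rho> "{0..R}"] dest!: bspec[of _ _ \<rho>])
    moreover have "((\<lambda>y. 1 / (n * y)) has_real_derivative - 1 / (n * y\<^sup>2)) (at y)"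
      using \<open>0 < y\<close> \<open>0 < n\<close> by (auto intro!: derivative_eq_intros simp: field_simps power2_eq_square)
    ultimately have "((\<lambda>y. f (1 / (n * y))) has_real_derivative f' \<rho> * (- 1 / (n * y\<^sup>2))) (at y)"
      unfolding \<rho>_def by (rule DERIV_chain2)
    then show "(h has_real_derivative h' y) (at y)"
      by (simp add: h_def[abs_def] h'_def \<rho>_def)
    have "\<mu> / (n * (2 * L)\<^sup>2) \<le> - f' \<rho> / (n * y\<^sup>2)"
      using f'[of \<rho>] \<rho> \<open>0 < \<mu>\<close> \<open>0 < n\<close> \<open>0 < y\<close> y
      by (intro frac_le mult_left_mono power_mono) auto
    then show "m \<le> h' y"
      by (simp add: m_def h'_def \<rho>_def)
    have "- f' \<rho> / (n * y\<^sup>2) \<le> B / (n * (L / 2)\<^sup>2)"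
      using B[of \<rho>] \<rho> \<open>0 < n\<close> \<open>0 < L\<close> y \<open>0 \<le> B\<close>
      by (intro frac_le mult_left_mono power_mono) auto
    then show "h' y \<le> K"
      by (simp add: K_def h'_def \<rho>_def)
  qed
  have "0 < m" "0 \<le> K"
    using \<open>0 < \<mu>\<close> \<open>0 < n\<close> \<open>0 < L\<close> \<open>0 \<le> B\<close> by (auto simp: m_def K_def)
  have "m * (y - z)\<^sup>2 \<le> (y - z) * (h y - h z) \<and> \<bar>h y - h z\<bar> \<le> K * \<bar>y - z\<bar>"
    if "\<bar>y - L\<bar> < r" "\<bar>z - L\<bar> < r" for y z
    using that
  proof (induction z y rule: linorder_wlog)
    case (le z y)
    show ?case
    proof (cases "z = y")
      case False
      then have "z < y" using le by simp
      have "\<exists>u. z < u \<and> u < y \<and> h y - h z = (y - z) * h' u"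
        by (rule MVT2[OF \<open>z < y\<close>], rule h(1)) (use le in auto)
      then obtain u where u: "z < u" "u < y" "h y - h z = (y - z) * h' u"
        by blast
      then have "\<bar>u - L\<bar> < r"
        using le by auto
      then have "m \<le> h' u" "h' u \<le> K"
        by (auto intro: h)
      then have "m * (y - z)\<^sup>2 \<le> h' u * (y - z)\<^sup>2" "(y - z) * h' u \<le> (y - z) * K" "0 \<le> (y - z) * h' u"
        using \<open>z < y\<close> \<open>0 < m\<close> by (auto intro!: mult_right_mono mult_left_mono)
      then show ?thesis
        using \<open>z < y\<close> by (simp add: u(3) power2_eq_square mult_ac)
    qed simp
  next
    case (sym z y)
    then show ?case
      by (simp add: power2_commute[of z y] abs_minus_commute algebra_simps)
  qed
  then show ?thesis
    using r(1,2) \<open>0 < m\<close> \<open>0 \<le> K\<close> unfolding h_def by blast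
qed

section \<open>The dynamics of the gaps\<close>

lemma weight_eq_kernel_mass_diff:
  assumes "kernel \<eta> w" and "i + j < N" and "x i \<le> x (i + j)" "x (i + j) \<le> x (i + j + 1)"
  shows "weight \<eta> w N x i j = kernel_mass \<eta> w (x (i + j + 1) - x i) - kernel_mass \<eta> w (x (i + j) - x i)"
  using assms by (simp add: weight_def integral_kernel_ext_shift)

text \<open>Partial sums over the gaps telescope to \<open>kernel_mass\<close>. Either they already
  cover the horizon, or the sum passes the leader, whose weight supplies the missing mass.\<close>

lemma sum_weight_eq_1:
  assumes ker: "kernel \<eta> w" and "0 < \<eta>" and "i < N"
    and mono: "\<And>k. k < N \<Longrightarrow> x k \<le> x (k + 1)"
    and covered: "i + n \<le> N \<Longrightarrow> \<eta> \<le> x (i + n) - x i"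
  shows "(\<Sum>j<n. weight \<eta> w N x i j) = 1"
proof -
  have mono': "x i \<le> x (i + j)" if "i + j \<le> N" for j
    using that
  proof (induction j)
    case (Suc j)
    then show ?case using mono[of "i + j"] by simp
  qed simp
  have partial: "(\<Sum>j<m. weight \<eta> w N x i j) = kernel_mass \<eta> w (x (i + m) - x i)" if "i + m \<le> N" for m
    using that
  proof (induction m)
    case (Suc m)
    then show ?case
      using mono[of "i + m"] mono'[of m] by (simp add: weight_eq_kernel_mass_diff[OF ker])
  qed (simp add: kernel_mass_0)
  show ?thesis
  proof (cases "i + n \<le> N")
    case True
    then show ?thesis
      using partial covered kernel_mass_eq_1[OF ker] by simp
  next
    case False
    \<comment> \<open>The index \<open>j = N - i\<close> stands for the road ahead of the leader;
      later weights vanish.\<close>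
    have "(\<Sum>j<n. weight \<eta> w N x i j) = (\<Sum>j<Suc (N - i). weight \<eta> w N x i j)"
      using False \<open>i < N\<close> by (intro sum.mono_neutral_right) (auto simp: weight_def)
    also have "\<dots> = kernel_mass \<eta> w (x N - x i) + weight \<eta> w N x i (N - i)"
      using partial[of "N - i"] \<open>i < N\<close> by simp
    also have "weight \<eta> w N x i (N - i) = 1 - kernel_mass \<eta> w (min (x N - x i) \<eta>)"
    proof -
      have "min (x N) (x i + \<eta>) - x i = min (x N - x i) \<eta>" by linarith
      moreover have "x i \<le> x N"
        using mono'[of "N - i"] \<open>i < N\<close> by simp
      ultimately show ?thesis
        using \<open>i < N\<close> \<open>0 < \<eta>\<close> kernel_mass_eq_1[OF ker order_refl]
        by (simp add: weight_def integral_kernel_ext_shift[OF ker])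
    qed
    also have "kernel_mass \<eta> w (min (x N - x i) \<eta>) = kernel_mass \<eta> w (x N - x i)"
      using kernel_mass_eq_1[OF ker] by (simp add: min_def)
    finally show ?thesis by simp
  qed
qed

text \<open>The weight that car \<open>i\<close> gives to the gap \<open>k \<ge> i\<close>, i.e. \<open>\<gamma>\<^sub>i\<^sub>,\<^sub>k\<^sub>-\<^sub>i\<close> in the paper.\<close>

definition gap_weight :: "real \<Rightarrow> (real \<Rightarrow> real) \<Rightarrow> nat \<Rightarrow> nat \<Rightarrow> (nat \<Rightarrow> real) \<Rightarrow> real" where
  "gap_weight \<eta> w i k y = kernel_mass \<eta> w (positions y (k + 1) - positions y i)
     - kernel_mass \<eta> w (positions y k - positions y i)"

lemma positions_diff: "i \<le> k \<Longrightarrow> positions y k - positions y i = (\<Sum>l\<in>{i..<k}. y l)"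
  unfolding positions_def
  using sum_diff_nat_ivl[of 0 i k y] by (simp add: atLeast0LessThan)

lemma positions_diff_nonneg:
  assumes "y \<in> gap_domain N" and "i \<le> k" "k \<le> N"
  shows "0 \<le> positions y k - positions y i"
  unfolding positions_diff[OF assms(2)]
  using assms by (intro sum_nonneg) (auto simp: gap_domain_def less_imp_le)

lemma gap_weight_bounds:
  assumes ker: "kernel \<eta> w" "0 < \<eta>" and "y \<in> gap_domain N" and "i \<le> k" "k < N"
  shows "0 \<le> gap_weight \<eta> w i k y" and "gap_weight \<eta> w i k y \<le> 1"
proof -
  have pos: "0 \<le> positions y k - positions y i" "positions y k \<le> positions y (k + 1)"
    using positions_diff_nonneg[OF assms(3), of i k] positions_diff_nonneg[OF assms(3), of k "k + 1"] assms(4,5)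
    by auto
  then show "0 \<le> gap_weight \<eta> w i k y"
    using kernel_mass_mono[OF ker pos(1)] by (simp add: gap_weight_def)
  define z where "z = positions y (k + 1) - positions y i"
  have "kernel_mass \<eta> w z \<le> kernel_mass \<eta> w (max z \<eta>)"
    using pos by (intro kernel_mass_mono[OF ker]) (auto simp: z_def)
  also have "\<dots> = 1"
    by (intro kernel_mass_eq_1[OF ker(1)]) simp
  finally show "gap_weight \<eta> w i k y \<le> 1"
    using kernel_mass_mono[OF ker order_refl pos(1)] by (simp add: gap_weight_def z_def kernel_mass_0)
qed

text \<open>The weight of the gap directly ahead depends on that gap alone; its positivity is the
  source of the damping.\<close>

lemma gap_weight_self: "gap_weight \<eta> w i i y = kernel_mass \<eta> w (y i)"
  by (simp add: gap_weight_def kernel_mass_0 positions_def)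

lemma near_lipschitz_positions: "k \<le> N \<Longrightarrow> near_lipschitz N r p (\<lambda>y. positions y k)"
  unfolding positions_def by (intro near_lipschitz_sum near_lipschitz_coord) auto

lemma near_lipschitz_gap_weight:
  assumes ker: "kernel \<eta> w" "0 < \<eta>" and D: "\<And>y. near N r y p \<Longrightarrow> y \<in> gap_domain N"
    and "i \<le> k" "k < N"
  shows "near_lipschitz N r p (gap_weight \<eta> w i k)"
proof -
  have "0 \<le> w 0"
    using kernel_ext_bounds[OF ker, of 0] by linarith
  have "near_lipschitz N r p (\<lambda>y. kernel_mass \<eta> w (positions y l - positions y i))"
    if "i \<le> l" "l \<le> N" for l
  proof (rule near_lipschitz_compose[where S = "{0..}" and \<phi> = "kernel_mass \<eta> w", OF _ _ \<open>0 \<le> w 0\<close>])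
    show "near_lipschitz N r p (\<lambda>y. positions y l - positions y i)"
      using that by (intro near_lipschitz_diff near_lipschitz_positions) auto
  qed (use positions_diff_nonneg[OF D] that kernel_mass_lipschitz[OF ker] in auto)
  then show ?thesis
    unfolding gap_weight_def[abs_def] using assms(4,5) by (intro near_lipschitz_diff) auto
qed

text \<open>As the weights sum to one, \<open>vbar\<close> can be split off, which removes the terms
  beyond the leader. For \<open>i = N\<close> the sum is empty, so the leader is included, as the
  equation of the last gap requires.\<close>

lemma car_speed_eq:
  assumes ker: "kernel \<eta> w" "0 < \<eta>" and y: "y \<in> gap_domain N" and "horizon_covered \<eta> N n y" and "i \<le> N"
  shows "car_speed \<eta> w v vbar N n \<omega> (positions y) i =
    vbar + (\<Sum>k\<in>{i..<min (i + n) N}. gap_weight \<eta> w i k y * (v (1 / (real N * y k)) (\<omega> k) - vbar))"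
proof (cases "i < N")
  case True
  have mono: "positions y k \<le> positions y (k + 1)" if "k < N" for k
    using y that by (auto simp: positions_def gap_domain_def less_imp_le)
  have "(\<Sum>j<n. weight \<eta> w N (positions y) i j) = 1"
    using ker True mono assms(4) by (intro sum_weight_eq_1) (auto simp: horizon_covered_def)
  then have "car_speed \<eta> w v vbar N n \<omega> (positions y) i =
      vbar + (\<Sum>j<n. weight \<eta> w N (positions y) i j * (local_speed v vbar N \<omega> (positions y) i j - vbar))"
    using True by (simp add: car_speed_def right_diff_distrib sum_subtractf sum_distrib_right[symmetric])
  also have "(\<Sum>j<n. weight \<eta> w N (positions y) i j * (local_speed v vbar N \<omega> (positions y) i j - vbar)) =
      (\<Sum>j\<in>{j. j < n \<and> i + j < N}.
        weight \<eta> w N (positions y) i j * (local_speed v vbar N \<omega> (positions y) i j - vbar))"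
    by (intro sum.mono_neutral_right) (auto simp: local_speed_def)
  also have "\<dots> = (\<Sum>k\<in>{i..<min (i + n) N}. gap_weight \<eta> w i k y * (v (1 / (real N * y k)) (\<omega> k) - vbar))"
  proof (rule sum.reindex_bij_witness[of _ "\<lambda>k. k - i" "\<lambda>j. i + j"])
    fix j assume j: "j \<in> {j. j < n \<and> i + j < N}"
    then have "weight \<eta> w N (positions y) i j = gap_weight \<eta> w i (i + j) y"
      using positions_diff_nonneg[OF y, of i "i + j"] mono[of "i + j"]
      by (simp add: weight_eq_kernel_mass_diff[OF ker(1)] gap_weight_def)
    then show "gap_weight \<eta> w i (i + j) y * (v (1 / (real N * y (i + j))) (\<omega> (i + j)) - vbar) =
        weight \<eta> w N (positions y) i j * (local_speed v vbar N \<omega> (positions y) i j - vbar)"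
      using j by (simp add: local_speed_def positions_def)
  qed auto
  finally show ?thesis .
qed (use assms(5) in \<open>simp add: car_speed_def\<close>)

theorem theorem3p2:
  fixes \<eta> vbar v'max :: real
    and w rho_max :: "real \<Rightarrow> real"
    and v v_rho v_rho2 v_omega :: "real \<Rightarrow> real \<Rightarrow> real"
    and N N\<^sub>\<eta> :: nat
    and \<omega> L :: "nat \<Rightarrow> real"
  assumes "0 < \<eta>" and "kernel \<eta> w"
    and "velocity_law v v_rho v_rho2 v_omega rho_max"
    and "1 \<le> N"
    and "\<forall>i<N. 0 < \<omega> i"
    and "0 < vbar" and "\<forall>i<N. vbar \<le> \<omega> i"
    and "\<forall>i<N. 0 < L i \<and> 1 / (real N * L i) \<in> {0..rho_max (\<omega> i)} \<and> v (1 / (real N * L i)) (\<omega> i) = vbar"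
    and "\<exists>r>0. \<forall>y. near N r y L \<longrightarrow> horizon_covered \<eta> N N\<^sub>\<eta> y"
    and "v'max < 0" and "\<forall>i<N. \<forall>\<rho>\<in>{0..rho_max (\<omega> i)}. v_rho \<rho> (\<omega> i) \<le> v'max"
  shows "asymptotically_stable N (gap_domain N) (gap_field \<eta> w v vbar N N\<^sub>\<eta> \<omega>) L"
proof -
  define g where "g k z = v (1 / (real N * z)) (\<omega> k) - vbar" for k z
  define bounds where "bounds k r m K \<longleftrightarrow> 0 < r \<and> r \<le> L k / 2 \<and> 0 < m \<and> 0 \<le> K \<and>
    (\<forall>y z. \<bar>y - L k\<bar> < r \<longrightarrow> \<bar>z - L k\<bar> < r \<longrightarrow>
      m * (y - z)\<^sup>2 \<le> (y - z) * (g k y - g k z) \<and> \<bar>g k y - g k z\<bar> \<le> K * \<bar>y - z\<bar>)"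
    for k and r m K :: real
  have "\<exists>r m K. bounds k r m K" if "k < N" for k
  proof -
    define R where "R = rho_max (\<omega> k)"
    have "0 < \<omega> k" using assms(5) that by blast
    then have v: "v R (\<omega> k) = 0" "C1_with_deriv (\<lambda>\<rho>. v \<rho> (\<omega> k)) (\<lambda>\<rho>. v_rho \<rho> (\<omega> k)) {0..R}"
      using assms(3) by (simp_all add: velocity_law_def R_def)
    have L: "0 < L k" "1 / (real N * L k) \<in> {0..R}" "v (1 / (real N * L k)) (\<omega> k) = vbar"
      using assms(8) that by (simp_all add: R_def)
    \<comment> \<open>The speed is 0 at the maximal density but \<open>vbar > 0\<close> at
      equilibrium, which gives the strict inequality required by
      \<open>congestion_law_bounds\<close>.\<close>
    then have "1 / (real N * L k) \<noteq> R"
      using v(1) assms(6) by auto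
    then have "1 / (real N * L k) < R"
      using L(2) by simp
    then show ?thesis
      unfolding bounds_def g_def
      using congestion_law_bounds[OF v(2), of "- v'max" "real N" "L k"] assms(4,10,11) that L(1)
      by (simp add: R_def)
  qed
  then have "\<forall>k. \<exists>s. k < N \<longrightarrow> bounds k (fst s) (fst (snd s)) (snd (snd s))"
    by (metis fst_conv snd_conv)
  then obtain s where s: "\<And>k. k < N \<Longrightarrow> bounds k (fst (s k)) (fst (snd (s k))) (snd (snd (s k)))"
    by metis
  obtain r\<^sub>h where "0 < r\<^sub>h" and r\<^sub>h: "\<And>y. near N r\<^sub>h y L \<Longrightarrow> horizon_covered \<eta> N N\<^sub>\<eta> y"
    using assms(9) by blast
  \<comment> \<open>Constants uniform in \<open>k\<close>: minima for the radius and the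
    monotonicity, a sum of nonnegative terms for the Lipschitz bound. \<open>\<gamma>\<close> bounds
    the own weight below, since gaps in the ball are at least \<open>L k / 2\<close>.\<close>
  define r where "r = Min (insert r\<^sub>h ((\<lambda>k. fst (s k)) ` {..<N}))"
  define m where "m = Min ((\<lambda>k. fst (snd (s k))) ` {..<N})"
  define K where "K = (\<Sum>k<N. snd (snd (s k)))"
  define \<gamma> where "\<gamma> = Min ((\<lambda>k. kernel_mass \<eta> w (L k / 2)) ` {..<N})"
  have "0 < r"
    using \<open>0 < r\<^sub>h\<close> s by (auto simp: r_def bounds_def)
  have "N \<noteq> 0"
    using assms(4) by simp
  then have "0 < m"
    using s by (auto simp: m_def bounds_def lessThan_empty_iff)
  have "0 \<le> K"
    using s by (auto simp: K_def bounds_def intro!: sum_nonneg)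
  have "0 < \<gamma>"
    using kernel_mass_pos[OF assms(2,1)] assms(8) \<open>N \<noteq> 0\<close> by (auto simp: \<gamma>_def lessThan_empty_iff)
  have r_le: "r \<le> L k / 2"
    and g_mono: "\<And>y. \<bar>y - L k\<bar> < r \<Longrightarrow> m * (y - L k)\<^sup>2 \<le> (y - L k) * g k y"
    and g_lip: "\<And>y z. \<bar>y - L k\<bar> < r \<Longrightarrow> \<bar>z - L k\<bar> < r \<Longrightarrow> \<bar>g k y - g k z\<bar> \<le> K * \<bar>y - z\<bar>"
    if "k < N" for k
  proof -
    note sk = s[OF that, unfolded bounds_def]
    have le: "r \<le> fst (s k)" "m \<le> fst (snd (s k))" "snd (snd (s k)) \<le> K"
      using that s by (auto simp: r_def m_def K_def bounds_def intro!: Min_le member_le_sum)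
    then show "r \<le> L k / 2"
      using sk by linarith
    have "g k (L k) = 0"
      using assms(8) that by (simp add: g_def)
    show "m * (y - L k)\<^sup>2 \<le> (y - L k) * g k y" if "\<bar>y - L k\<bar> < r" for y
    proof -
      have "m * (y - L k)\<^sup>2 \<le> fst (snd (s k)) * (y - L k)\<^sup>2"
        using le by (intro mult_right_mono) auto
      also have "\<dots> \<le> (y - L k) * (g k y - g k (L k))"
        using sk that le \<open>0 < r\<close> by simp
      finally show ?thesis using \<open>g k (L k) = 0\<close> by simp
    qed
    show "\<bar>g k y - g k z\<bar> \<le> K * \<bar>y - z\<bar>" if "\<bar>y - L k\<bar> < r" "\<bar>z - L k\<bar> < r" for y z
    proof -
      have "\<bar>g k y - g k z\<bar> \<le> snd (snd (s k)) * \<bar>y - z\<bar>"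
        using sk that le by simp
      also have "\<dots> \<le> K * \<bar>y - z\<bar>"
        using le by (intro mult_right_mono) auto
      finally show ?thesis .
    qed
  qed
  have g_L: "g k (L k) = 0" if "k < N" for k
    using assms(8) that by (simp add: g_def)
  have D: "y \<in> gap_domain N" if "near N r y L" for y
    using that r_le assms(8) by (force simp: near_def gap_domain_def)
  have covered: "horizon_covered \<eta> N N\<^sub>\<eta> y" if "near N r y L" for y
    by (rule r\<^sub>h, rule near_mono[OF that]) (simp add: r_def)
  have L_near: "near N r L L"
    using \<open>0 < r\<close> by (simp add: near_def)
  \<comment> \<open>A zero look-ahead would make \<open>horizon_covered\<close> claim
    \<open>\<eta> \<le> 0\<close>. This ensures that the own gap occurs in the sum
    \<open>S i\<close>.\<close>
  have "N\<^sub>\<eta> \<noteq> 0"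
  proof
    assume "N\<^sub>\<eta> = 0"
    then have "\<eta> \<le> positions L 0 - positions L 0"
      using covered[OF L_near] unfolding horizon_covered_def by (metis add_0 le0)
    then show False using assms(1) by simp
  qed
  \<comment> \<open>\<open>S i y\<close> is the deviation of the speed of car \<open>i\<close> from
    \<open>vbar\<close>.\<close>
  define S where "S i y = (\<Sum>k\<in>{i..<min (i + N\<^sub>\<eta>) N}. gap_weight \<eta> w i k y * g k (y k))" for i y
  have F_eq: "gap_field \<eta> w v vbar N N\<^sub>\<eta> \<omega> y i = S (i + 1) y - S i y"
    if "near N r y L" "i < N" for y i
    using car_speed_eq[OF assms(2,1) D[OF that(1)] covered[OF that(1)]] that(2)
    by (simp add: gap_field_def S_def g_def)
  have S_lip: "near_lipschitz N r L (S i)" for i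
    unfolding S_def[abs_def]
  proof (rule near_lipschitz_sum, rule near_lipschitz_mult[OF _ _ \<open>0 < r\<close>])
    fix k assume k: "k \<in> {i..<min (i + N\<^sub>\<eta>) N}"
    then show "near_lipschitz N r L (gap_weight \<eta> w i k)"
      using D by (intro near_lipschitz_gap_weight[OF assms(2,1)]) auto
    show "near_lipschitz N r L (\<lambda>y. g k (y k))"
      using k g_lip
      by (intro near_lipschitz_compose[OF near_lipschitz_coord _ \<open>0 \<le> K\<close>, where S = "{z. \<bar>z - L k\<bar> < r}"])
        (auto simp: near_def)
  qed
  define F where "F = gap_field \<eta> w v vbar N N\<^sub>\<eta> \<omega>"
  have F_lip: "near_lipschitz N r L (\<lambda>y. F y i)" if "i < N" for i
    using near_lipschitz_cong[of N r L "\<lambda>y. F y i" "\<lambda>y. S (i + 1) y - S i y"]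
      near_lipschitz_diff[OF S_lip S_lip] F_eq that by (simp add: F_def)
  \<comment> \<open>The general index set \<open>A\<close> serves both the speed of the car ahead
    (\<open>i' = i + 1\<close>) and the part of the own speed due to gaps further ahead
    (\<open>i' = i\<close>).\<close>
  have tail: "\<bar>\<Sum>k\<in>A. gap_weight \<eta> w i' k y * g k (y k)\<bar> \<le> K * (\<Sum>k\<in>{i<..<N}. \<bar>y k - L k\<bar>)"
    if y: "near N r y L" and A: "A \<subseteq> {i<..<N}" "A \<subseteq> {i'..}" for y A i i'
  proof -
    have "\<bar>\<Sum>k\<in>A. gap_weight \<eta> w i' k y * g k (y k)\<bar> \<le> (\<Sum>k\<in>A. \<bar>gap_weight \<eta> w i' k y * g k (y k)\<bar>)"
      by (rule sum_abs)
    also have "\<dots> \<le> (\<Sum>k\<in>A. K * \<bar>y k - L k\<bar>)"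
    proof (rule sum_mono)
      fix k assume "k \<in> A"
      then have k: "i' \<le> k" "k < N" using A by auto
      have "\<bar>g k (y k)\<bar> \<le> K * \<bar>y k - L k\<bar>"
        using g_lip[OF k(2), of "y k" "L k"] y \<open>0 < r\<close> g_L[OF k(2)] k by (simp add: near_def)
      moreover have "\<bar>gap_weight \<eta> w i' k y\<bar> \<le> 1"
        using gap_weight_bounds[OF assms(2,1) D[OF y] k] by simp
      ultimately have "\<bar>gap_weight \<eta> w i' k y\<bar> * \<bar>g k (y k)\<bar> \<le> 1 * (K * \<bar>y k - L k\<bar>)"
        by (intro mult_mono) auto
      then show "\<bar>gap_weight \<eta> w i' k y * g k (y k)\<bar> \<le> K * \<bar>y k - L k\<bar>"
        by (simp add: abs_mult)
    qed
    also have "\<dots> \<le> (\<Sum>k\<in>{i<..<N}. K * \<bar>y k - L k\<bar>)"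
      using A \<open>0 \<le> K\<close> by (intro sum_mono2) auto
    finally show ?thesis by (simp add: sum_distrib_left)
  qed
  have tri: "(y i - L i) * F y i \<le>
      - (\<gamma> * m) * (y i - L i)\<^sup>2 + (2 * K) * \<bar>y i - L i\<bar> * (\<Sum>k\<in>{i<..<N}. \<bar>y k - L k\<bar>)"
    if y: "near N r y L" and i: "i < N" for y i
  proof -
    define e where "e = y i - L i"
    define X where "X = K * (\<Sum>k\<in>{i<..<N}. \<bar>y k - L k\<bar>)"
    define W where "W = kernel_mass \<eta> w (y i)"
    define U where "U = (\<Sum>k\<in>{i<..<min (i + N\<^sub>\<eta>) N}. gap_weight \<eta> w i k y * g k (y k))"
    have "{i..<min (i + N\<^sub>\<eta>) N} = insert i {i<..<min (i + N\<^sub>\<eta>) N}"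
      using i \<open>N\<^sub>\<eta> \<noteq> 0\<close> by auto
    then have S: "S i y = W * g i (y i) + U"
      by (simp add: S_def U_def W_def gap_weight_self)
    have "\<bar>S (i + 1) y\<bar> \<le> X" "\<bar>U\<bar> \<le> X"
      unfolding S_def U_def X_def by (intro tail[OF y]; auto)+
    then have "\<bar>e * S (i + 1) y\<bar> \<le> \<bar>e\<bar> * X" "\<bar>e * U\<bar> \<le> \<bar>e\<bar> * X"
      by (auto simp: abs_mult intro: mult_left_mono)
    then have "e * S (i + 1) y \<le> \<bar>e\<bar> * X" "- (e * U) \<le> \<bar>e\<bar> * X"
      by linarith+
    moreover have "\<gamma> * (m * e\<^sup>2) \<le> W * (e * g i (y i))"
    proof (rule mult_mono)
      have yi: "\<bar>y i - L i\<bar> < r" "L i / 2 \<le> y i" "0 < L i"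
        using y i r_le[OF i] assms(8) by (force simp: near_def)+
      have "\<gamma> \<le> kernel_mass \<eta> w (L i / 2)"
        using i by (auto simp: \<gamma>_def)
      also have "\<dots> \<le> W"
        unfolding W_def using yi by (intro kernel_mass_mono[OF assms(2,1)]) auto
      finally show "\<gamma> \<le> W" .
      then show "0 \<le> W" using \<open>0 < \<gamma>\<close> by simp
      show "m * e\<^sup>2 \<le> e * g i (y i)"
        unfolding e_def by (rule g_mono[OF i yi(1)])
      show "0 \<le> m * e\<^sup>2" using \<open>0 < m\<close> by simp
    qed
    \<comment> \<open>A gap shrinks when its follower speeds up, so the own gap enters with a minus
      sign; the other two terms are coupling, whence the factor 2 on \<open>K\<close>.\<close>
    moreover have "e * F y i = e * S (i + 1) y - W * (e * g i (y i)) - e * U"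
      by (simp add: F_def F_eq[OF y i] S algebra_simps)
    ultimately have "e * F y i \<le> - (\<gamma> * m) * e\<^sup>2 + 2 * (\<bar>e\<bar> * X)"
      by simp
    then show ?thesis by (simp add: e_def X_def mult_ac)
  qed
  \<comment> \<open>The ratio from \<open>triangular_dissipation_weighted\<close> for damping
    \<open>\<gamma> * m\<close> and coupling \<open>2 * K\<close>.\<close>
  define M where "M = 2 + 2 * real N * (2 * K)\<^sup>2 / (\<gamma> * m)\<^sup>2"
  have "1 \<le> M"
    by (simp add: M_def)
  have "asymptotically_stable N (gap_domain N) F L"
  proof (rule asymptotically_stable_if_weighted_sq_dissipative[OF \<open>0 < r\<close>, where a = "\<lambda>i. M ^ i" and \<kappa> = "\<gamma> * m / 4"])
    show "F L i = 0" if "i < N" for i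
      using F_eq[OF L_near that] g_L by (simp add: F_def S_def)
    show "(\<Sum>i<N. M ^ i * ((y i - L i) * F y i)) \<le> - (\<gamma> * m / 4) * weighted_sq N (\<lambda>i. M ^ i) L y"
      if "near N r y L" for y
      unfolding weighted_sq_def
      using \<open>0 < \<gamma>\<close> \<open>0 < m\<close> tri[OF that] by (intro triangular_dissipation_weighted[OF _ M_def]) auto
  qed (use \<open>1 \<le> M\<close> \<open>0 < \<gamma>\<close> \<open>0 < m\<close> D F_lip in auto)
  then show ?thesis
    by (simp add: F_def)
qed

end
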